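(* Let $g\in H^\infty(\mathbb{D})$ be such that $g(\mathbb{D})\cap\mathbb{D}=\varnothing$, $|g|>1$ almost everywhere on $\mathbb{T}$, and $\log(|g|-1)\in L^1(\mathbb{T})$. Then for every $k>0$ and every non-zero $f\in H^2(\mathbb{D})$, $\lim_{n\to\infty}n^{-k}\|(T_g^* )^nf\|=+\infty$.
   Context: $\mathbb{D}$ is the open unit disk, $\mathbb{T}$ the unit circle with normalized Lebesgue measure; $H^\infty$ functions are identified with their boundary values on $\mathbb{T}$. $H^2(\mathbb{D})\subseteq L^2(\mathbb{T})$; for $g\in L^\infty(\mathbb{T})$, $T_g=PM_g$ with $M_g$ multiplication by $g$ and $P$ the orthogonal projection of $L^2(\mathbb{T})$ onto $H^2(\mathbb{D})$; $T_g^*$ is the Hilbert space adjoint. *)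

theory Defs
  imports "HOL-Analysis.Analysis"
begin

text \<open>The unit circle T is parametrised by t in [0,1] via t |-> cis(2 pi t); the pulled-back
Lebesgue measure on [0,1] is the normalized Lebesgue measure on T. Functions on T are
represented as functions complex => complex (only their values on T matter).\<close>

definition circ :: "real \<Rightarrow> complex" where
  "circ t = cis (2 * pi * t)"

definition L2T :: "(complex \<Rightarrow> complex) \<Rightarrow> bool" where
  "L2T h \<longleftrightarrow> (\<lambda>t. h (circ t)) \<in> borel_measurable lborel \<and>
     set_integrable lborel {0..1} (\<lambda>t. (cmod (h (circ t)))\<^sup>2)"

definition L2norm :: "(complex \<Rightarrow> complex) \<Rightarrow> real" where
  "L2norm h = sqrt (LINT t:{0..1}|lborel. (cmod (h (circ t)))\<^sup>2)"

definition fcoeff :: "(complex \<Rightarrow> complex) \<Rightarrow> int \<Rightarrow> complex" where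
  "fcoeff h n = (LINT t:{0..1}|lborel. h (circ t) * cis (- 2 * pi * of_int n * t))"

definition H2 :: "(complex \<Rightarrow> complex) \<Rightarrow> bool" where
  "H2 h \<longleftrightarrow> L2T h \<and> (\<forall>n<0. fcoeff h n = 0)"

text \<open>H^infinity, identified with boundary values: essentially bounded functions in H^2.\<close>
definition Hinf :: "(complex \<Rightarrow> complex) \<Rightarrow> bool" where
  "Hinf h \<longleftrightarrow> H2 h \<and> (\<exists>C. AE t in lborel. t \<in> {0..1} \<longrightarrow> cmod (h (circ t)) \<le> C)"

definition disc_ext :: "(complex \<Rightarrow> complex) \<Rightarrow> complex \<Rightarrow> complex" where
  "disc_ext h z = (\<Sum>n. fcoeff h (int n) * z ^ n)"

text \<open>Orthogonal (Riesz) projection P of L^2(T) onto H^2 (a representative of the class).\<close>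
definition Proj :: "(complex \<Rightarrow> complex) \<Rightarrow> (complex \<Rightarrow> complex)" where
  "Proj h = (SOME p. H2 p \<and> (\<forall>n\<ge>0. fcoeff p n = fcoeff h n))"

text \<open>Adjoint of the Toeplitz operator T_g: T_g^* = T_{conj g} = P M_{conj g}.\<close>
definition Toeplitz_adj :: "(complex \<Rightarrow> complex) \<Rightarrow> (complex \<Rightarrow> complex) \<Rightarrow> (complex \<Rightarrow> complex)" where
  "Toeplitz_adj g f = Proj (\<lambda>z. cnj (g z) * f z)"

end

theory Submission
  imports Defs "HOL-Complex_Analysis.Complex_Analysis" "HOL-Probability.Probability"
    "HOL-Real_Asymp.Real_Asymp"
begin

text \<open>
Put u = 1/g, which is holomorphic and bounded by 1 in the disc. If f_n = (T_g^*)^n f, then f is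
recovered from f_n by T_{u^n}^*, so <f, h> = <f_n, u^n h> for every h in H^2 and hence
|<f, h>| <= ||f_n|| ||u^n h||. The test functions are h = z^j exp(P) with P a polynomial such that
Re P <= 0 on the circle, P(0) is real and Re P is L^1-close to min(0, L + m log(1 - |u|)); the
entire function exp(P) replaces an outer function, so no boundary values of Herglotz integrals are
needed. Since |u|^n (1 - |u|)^m <= (m/n)^m, this makes ||u^n h|| at most of order e^L (m/n)^m. On the
other hand ||h - z^j||^2 <= 2 - 2 exp(P(0)), and P(0) is the mean of Re P, which is close to 0 once L
is large because log(1 - |u|) is integrable. So if the j-th coefficient of f is non-zero, <f, h> stays
away from 0, and ||f_n|| grows at least like n^m for every m.

That u^n h belongs to H^2 is obtained from the dilations G(r z) of the holomorphic extension G of g: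
they converge to g in L^2, and x -> 1/x is 1-Lipschitz on |x| >= 1.
\<close>

section \<open>Square-integrable functions\<close>

definition square_integrable :: "'a measure \<Rightarrow> ('a \<Rightarrow> complex) \<Rightarrow> bool" where
  "square_integrable M a \<longleftrightarrow> a \<in> borel_measurable M \<and> integrable M (\<lambda>x. (cmod (a x))\<^sup>2)"

definition l2_norm :: "'a measure \<Rightarrow> ('a \<Rightarrow> complex) \<Rightarrow> real" where
  "l2_norm M a = sqrt (\<integral>x. (cmod (a x))\<^sup>2 \<partial>M)"

definition l2_inner :: "'a measure \<Rightarrow> ('a \<Rightarrow> complex) \<Rightarrow> ('a \<Rightarrow> complex) \<Rightarrow> complex" where
  "l2_inner M a b = (\<integral>x. a x * cnj (b x) \<partial>M)"

lemma borel_measurable_cnj [measurable (raw)]: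
  "f \<in> borel_measurable M \<Longrightarrow> (\<lambda>x. cnj (f x)) \<in> borel_measurable M"
  by (rule borel_measurable_continuous_on[where f=cnj]) (auto intro: continuous_intros)

lemma square_integrable_measurable [measurable_dest]:
  "square_integrable M a \<Longrightarrow> a \<in> borel_measurable M"
  by (simp add: square_integrable_def)

lemma square_integrable_integrable_norm_power2:
  "square_integrable M a \<Longrightarrow> integrable M (\<lambda>x. (cmod (a x))\<^sup>2)"
  by (simp add: square_integrable_def)

lemma l2_norm_nonneg [simp]: "0 \<le> l2_norm M a"
  by (simp add: l2_norm_def)

lemma l2_norm_power2: "(l2_norm M a)\<^sup>2 = (\<integral>x. (cmod (a x))\<^sup>2 \<partial>M)"
  by (simp add: l2_norm_def)

lemma l2_norm_minus_commute: "l2_norm M (\<lambda>x. a x - b x) = l2_norm M (\<lambda>x. b x - a x)"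
  by (simp add: l2_norm_def norm_minus_commute)

lemma l2_inner_self: "l2_inner M a a = complex_of_real ((l2_norm M a)\<^sup>2)"
  unfolding l2_inner_def l2_norm_power2 complex_norm_square[symmetric] of_real_power[symmetric]
  by (rule integral_complex_of_real)

lemma cnj_l2_inner: "cnj (l2_inner M a b) = l2_inner M b a"
  unfolding l2_inner_def Bochner_Integration.integral_cnj[symmetric] by (simp add: mult.commute)

lemma square_integrable_AE_le:
  assumes b: "square_integrable M b" and [measurable]: "a \<in> borel_measurable M"
    and dominated: "AE x in M. cmod (a x) \<le> C * cmod (b x)"
  shows "square_integrable M a"
  unfolding square_integrable_def
proof (rule conjI[OF _ Bochner_Integration.integrable_bound])
  show "integrable M (\<lambda>x. C\<^sup>2 * (cmod (b x))\<^sup>2)"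
    using b by (simp add: square_integrable_def)
  show "AE x in M. norm ((cmod (a x))\<^sup>2) \<le> norm (C\<^sup>2 * (cmod (b x))\<^sup>2)"
    using dominated by eventually_elim (force dest: power_mono[where n=2] simp: power_mult_distrib)
qed measurable

lemma l2_norm_AE_le:
  assumes b: "square_integrable M b" and a: "a \<in> borel_measurable M"
    and C: "0 \<le> C" and dominated: "AE x in M. cmod (a x) \<le> C * cmod (b x)"
  shows "l2_norm M a \<le> C * l2_norm M b"
proof -
  have "(\<integral>x. (cmod (a x))\<^sup>2 \<partial>M) \<le> (\<integral>x. C\<^sup>2 * (cmod (b x))\<^sup>2 \<partial>M)"
  proof (rule integral_mono_AE)
    show "integrable M (\<lambda>x. (cmod (a x))\<^sup>2)"
      using square_integrable_AE_le[OF b a dominated] by (simp add: square_integrable_def)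
    show "integrable M (\<lambda>x. C\<^sup>2 * (cmod (b x))\<^sup>2)"
      using b by (simp add: square_integrable_def)
    show "AE x in M. (cmod (a x))\<^sup>2 \<le> C\<^sup>2 * (cmod (b x))\<^sup>2"
      using dominated by eventually_elim (force dest: power_mono[where n=2] simp: power_mult_distrib)
  qed
  then have "(l2_norm M a)\<^sup>2 \<le> (C * l2_norm M b)\<^sup>2"
    by (simp add: power_mult_distrib l2_norm_power2)
  then show ?thesis
    using C by (simp add: power2_le_iff_abs_le)
qed

lemma square_integrable_cnj:
  "square_integrable M a \<Longrightarrow> square_integrable M (\<lambda>x. cnj (a x))"
  by (rule square_integrable_AE_le[where b=a and C=1]) auto

lemma square_integrable_cmult:
  "square_integrable M a \<Longrightarrow> square_integrable M (\<lambda>x. c * a x)"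
  by (rule square_integrable_AE_le[where b=a and C="cmod c"]) (auto simp: norm_mult)

lemma square_integrable_add:
  assumes a: "square_integrable M a" and b: "square_integrable M b"
  shows "square_integrable M (\<lambda>x. a x + b x)"
  unfolding square_integrable_def
proof (rule conjI[OF _ Bochner_Integration.integrable_bound])
  note [measurable] = a b
  show "(\<lambda>x. a x + b x) \<in> borel_measurable M" and "(\<lambda>x. (cmod (a x + b x))\<^sup>2) \<in> borel_measurable M"
    by measurable
  show "integrable M (\<lambda>x. 2 * (cmod (a x))\<^sup>2 + 2 * (cmod (b x))\<^sup>2)"
    using a b by (simp add: square_integrable_def)
  have "(cmod (x + y))\<^sup>2 \<le> 2 * (cmod x)\<^sup>2 + 2 * (cmod y)\<^sup>2" for x y
  proof -
    have "(cmod (x + y))\<^sup>2 \<le> (cmod x + cmod y)\<^sup>2"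
      by (intro power_mono norm_triangle_ineq) auto
    also have "\<dots> \<le> 2 * (cmod x)\<^sup>2 + 2 * (cmod y)\<^sup>2"
      using sum_squares_bound[of "cmod x" "cmod y"] by (simp add: power2_sum)
    finally show ?thesis .
  qed
  then show "AE x in M. norm ((cmod (a x + b x))\<^sup>2) \<le> norm (2 * (cmod (a x))\<^sup>2 + 2 * (cmod (b x))\<^sup>2)"
    by auto
qed

lemma square_integrable_diff:
  assumes "square_integrable M a" "square_integrable M b"
  shows "square_integrable M (\<lambda>x. a x - b x)"
  using square_integrable_add[OF assms(1) square_integrable_cmult[OF assms(2), of "-1"]] by simp

lemma square_integrable_sum:
  assumes "\<And>i. i \<in> I \<Longrightarrow> square_integrable M (a i)"
  shows "square_integrable M (\<lambda>x. \<Sum>i\<in>I. a i x)"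
proof -
  have "square_integrable M (\<lambda>x. 0)" by (simp add: square_integrable_def)
  then show ?thesis using assms
    by (induction I rule: infinite_finite_induct) (auto intro: square_integrable_add)
qed

lemma square_integrable_bounded_mult:
  assumes [measurable]: "square_integrable M a" "b \<in> borel_measurable M"
    and bounded: "AE x in M. cmod (b x) \<le> C"
  shows "square_integrable M (\<lambda>x. b x * a x)"
proof (rule square_integrable_AE_le[OF assms(1)])
  show "AE x in M. cmod (b x * a x) \<le> C * cmod (a x)"
    using bounded by eventually_elim (simp add: norm_mult mult_right_mono)
qed measurable

lemma (in finite_measure) square_integrable_const: "square_integrable M (\<lambda>_. c)"
  by (simp add: square_integrable_def)

lemma (in finite_measure) square_integrable_bounded:
  assumes "b \<in> borel_measurable M" "AE x in M. cmod (b x) \<le> C"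
  shows "square_integrable M b"
  using square_integrable_bounded_mult[OF square_integrable_const assms, of 1] by simp

lemma integrable_norm_mult:
  assumes [measurable]: "square_integrable M a" "square_integrable M b"
  shows "integrable M (\<lambda>x. cmod (a x) * cmod (b x))"
proof (rule Bochner_Integration.integrable_bound)
  show "integrable M (\<lambda>x. (cmod (a x))\<^sup>2 + (cmod (b x))\<^sup>2)"
    using assms by (simp add: square_integrable_def)
  have "x * y \<le> x\<^sup>2 + y\<^sup>2" if "0 \<le> x" "0 \<le> y" for x y :: real
    using sum_squares_bound[of x y] mult_nonneg_nonneg[OF that] by linarith
  then show "AE x in M. norm (cmod (a x) * cmod (b x)) \<le> norm ((cmod (a x))\<^sup>2 + (cmod (b x))\<^sup>2)"
    by auto
qed measurable

lemma integrable_mult_cnj: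
  assumes [measurable]: "square_integrable M a" "square_integrable M b"
  shows "integrable M (\<lambda>x. a x * cnj (b x))"
  by (rule Bochner_Integration.integrable_bound[OF integrable_norm_mult[OF assms]])
     (auto simp: norm_mult)

lemma (in finite_measure) integrable_of_square_integrable:
  "square_integrable M a \<Longrightarrow> integrable M a"
  using integrable_mult_cnj[OF _ square_integrable_const[of 1]] by simp

lemma Cauchy_Schwarz_integral_norm:
  assumes a: "square_integrable M a" and b: "square_integrable M b"
  shows "(\<integral>x. cmod (a x) * cmod (b x) \<partial>M) \<le> l2_norm M a * l2_norm M b"
proof -
  note [measurable] = a b
  define I where "I = (\<integral>x. cmod (a x) * cmod (b x) \<partial>M)"
  have nn_norm: "(\<integral>\<^sup>+x. ennreal ((cmod (c x))\<^sup>2) \<partial>M) = ennreal ((l2_norm M c)\<^sup>2)"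
    if "square_integrable M c" for c
    using that by (simp add: l2_norm_power2 nn_integral_eq_integral square_integrable_def)
  have "(\<integral>\<^sup>+x. ennreal (cmod (a x)) * ennreal (cmod (b x)) \<partial>M) = ennreal I"
    using integrable_norm_mult[OF a b]
    by (simp add: I_def nn_integral_eq_integral flip: ennreal_mult)
  then have "ennreal (I\<^sup>2) \<le> ennreal ((l2_norm M a)\<^sup>2 * (l2_norm M b)\<^sup>2)"
    using Cauchy_Schwarz_nn_integral[of "\<lambda>x. ennreal (cmod (a x))" M "\<lambda>x. ennreal (cmod (b x))"]
    by (simp add: nn_norm a b I_def ennreal_power ennreal_mult)
  then have "I\<^sup>2 \<le> (l2_norm M a * l2_norm M b)\<^sup>2"
    by (simp add: power_mult_distrib)
  then show ?thesis
    unfolding I_def by (rule power2_le_imp_le) simp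
qed

lemma norm_l2_inner_le:
  assumes a: "square_integrable M a" and b: "square_integrable M b"
  shows "cmod (l2_inner M a b) \<le> l2_norm M a * l2_norm M b"
proof -
  have "cmod (l2_inner M a b) \<le> (\<integral>x. cmod (a x * cnj (b x)) \<partial>M)"
    unfolding l2_inner_def by (rule integral_norm_bound)
  also have "\<dots> \<le> l2_norm M a * l2_norm M b"
    using Cauchy_Schwarz_integral_norm[OF a b] by (simp add: norm_mult)
  finally show ?thesis .
qed

lemma (in finite_measure) integral_norm_le_l2_norm:
  assumes "square_integrable M a"
  shows "(\<integral>x. cmod (a x) \<partial>M) \<le> l2_norm M a * sqrt (measure M (space M))"
  using Cauchy_Schwarz_integral_norm[OF assms square_integrable_const[of 1]]
  by (simp add: l2_norm_def)

lemma l2_inner_cong_AE: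
  assumes [measurable]: "a \<in> borel_measurable M" "b \<in> borel_measurable M" "c \<in> borel_measurable M"
    and "AE x in M. b x = c x"
  shows "l2_inner M a b = l2_inner M a c"
  unfolding l2_inner_def
proof (rule integral_cong_AE)
  show "AE x in M. a x * cnj (b x) = a x * cnj (c x)"
    using assms(4) by eventually_elim simp
qed measurable

lemma l2_inner_diff_left:
  assumes "square_integrable M a" "square_integrable M b" "square_integrable M c"
  shows "l2_inner M (\<lambda>x. a x - b x) c = l2_inner M a c - l2_inner M b c"
  unfolding l2_inner_def left_diff_distrib using assms
  by (intro Bochner_Integration.integral_diff integrable_mult_cnj)

lemma l2_inner_add_right:
  assumes "square_integrable M a" "square_integrable M b" "square_integrable M c"
  shows "l2_inner M a (\<lambda>x. b x + c x) = l2_inner M a b + l2_inner M a c"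
  unfolding l2_inner_def complex_cnj_add distrib_left using assms
  by (intro Bochner_Integration.integral_add integrable_mult_cnj)

lemma l2_inner_cmult_left: "l2_inner M (\<lambda>x. k * a x) b = k * l2_inner M a b"
  by (simp add: l2_inner_def mult.assoc)

lemma l2_inner_sum_left:
  assumes "\<And>i. i \<in> I \<Longrightarrow> square_integrable M (a i)" "square_integrable M b"
  shows "l2_inner M (\<lambda>x. \<Sum>i\<in>I. a i x) b = (\<Sum>i\<in>I. l2_inner M (a i) b)"
  unfolding l2_inner_def sum_distrib_right using assms
  by (intro Bochner_Integration.integral_sum integrable_mult_cnj)

lemma l2_inner_diff_right:
  assumes "square_integrable M a" "square_integrable M b" "square_integrable M c"
  shows "l2_inner M a (\<lambda>x. b x - c x) = l2_inner M a b - l2_inner M a c"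
  unfolding l2_inner_def complex_cnj_diff right_diff_distrib using assms
  by (intro Bochner_Integration.integral_diff integrable_mult_cnj)

lemma l2_inner_cmult_right: "l2_inner M a (\<lambda>x. k * b x) = cnj k * l2_inner M a b"
  using arg_cong[OF l2_inner_cmult_left[of M k b a], of cnj] by (simp add: cnj_l2_inner)

lemma l2_inner_sum_right:
  assumes "square_integrable M a" "\<And>i. i \<in> I \<Longrightarrow> square_integrable M (b i)"
  shows "l2_inner M a (\<lambda>x. \<Sum>i\<in>I. b i x) = (\<Sum>i\<in>I. l2_inner M a (b i))"
  using arg_cong[where f=cnj, OF l2_inner_sum_left[OF assms(2,1)]] by (simp add: cnj_l2_inner)

lemma l2_inner_cnj_cnj: "l2_inner M (\<lambda>x. cnj (a x)) (\<lambda>x. cnj (b x)) = cnj (l2_inner M a b)"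
  unfolding l2_inner_def Bochner_Integration.integral_cnj[symmetric] by simp

lemma norm_l2_inner_ge_half:
  assumes f: "square_integrable M f" and e: "square_integrable M e" and h: "square_integrable M h"
    and close: "l2_norm M (\<lambda>x. h x - e x) \<le> cmod (l2_inner M f e) / (2 * (l2_norm M f + 1))"
  shows "cmod (l2_inner M f e) / 2 \<le> cmod (l2_inner M f h)"
proof -
  have pos: "0 < l2_norm M f + 1"
    by (simp add: add_nonneg_pos)
  have "cmod (l2_inner M f h - l2_inner M f e) \<le> l2_norm M f * l2_norm M (\<lambda>x. h x - e x)"
    unfolding l2_inner_diff_right[OF f h e, symmetric]
    by (intro norm_l2_inner_le square_integrable_diff f h e)
  also have "\<dots> \<le> (l2_norm M f + 1) * (cmod (l2_inner M f e) / (2 * (l2_norm M f + 1)))"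
    using close by (intro mult_mono) auto
  also have "\<dots> = cmod (l2_inner M f e) / 2"
    using pos by (simp add: field_simps)
  finally show ?thesis
    using norm_triangle_sub[of "l2_inner M f e" "l2_inner M f h"] by (simp add: norm_minus_commute)
qed

lemma l2_inner_eq_0_closure:
  assumes q: "square_integrable M q" and b: "square_integrable M b"
    and approx: "\<And>e. 0 < e \<Longrightarrow>
      \<exists>b'. square_integrable M b' \<and> l2_inner M q b' = 0 \<and> l2_norm M (\<lambda>x. b x - b' x) \<le> e"
  shows "l2_inner M q b = 0"
proof (rule ccontr)
  assume nonzero: "l2_inner M q b \<noteq> 0"
  then have "0 < cmod (l2_inner M q b) / (2 * (l2_norm M q + 1))"
    by (simp add: add_nonneg_pos)
  then obtain b' where b': "square_integrable M b'" "l2_inner M q b' = 0"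
    and "l2_norm M (\<lambda>x. b x - b' x) \<le> cmod (l2_inner M q b) / (2 * (l2_norm M q + 1))"
    using approx by blast
  then have "cmod (l2_inner M q b) / 2 \<le> cmod (l2_inner M q b')"
    by (intro norm_l2_inner_ge_half q b) (simp_all add: l2_norm_minus_commute[of M b'])
  with b' nonzero show False by simp
qed

lemma tendsto_l2_inner_left:
  assumes S: "\<And>n. square_integrable M (S n)" and s: "square_integrable M s" and w: "square_integrable M w"
    and lim: "((\<lambda>n. l2_norm M (\<lambda>x. S n x - s x)) \<longlongrightarrow> 0) F"
  shows "((\<lambda>n. l2_inner M (S n) w) \<longlongrightarrow> l2_inner M s w) F"
proof (rule LIM_zero_cancel, rule Lim_null_comparison)
  show "\<forall>\<^sub>F n in F. norm (l2_inner M (S n) w - l2_inner M s w) \<le> l2_norm M (\<lambda>x. S n x - s x) * l2_norm M w"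
    unfolding l2_inner_diff_left[OF S s w, symmetric]
    by (intro always_eventually allI norm_l2_inner_le square_integrable_diff S s w)
  show "((\<lambda>n. l2_norm M (\<lambda>x. S n x - s x) * l2_norm M w) \<longlongrightarrow> 0) F"
    using tendsto_mult_right[OF lim] by simp
qed

lemma l2_norm_eq_0_AE:
  assumes "AE x in M. a x = 0"
  shows "l2_norm M a = 0"
proof -
  have "(\<integral>x. (cmod (a x))\<^sup>2 \<partial>M) = 0"
    using assms by (intro integral_eq_zero_AE) (auto elim: eventually_mono)
  then show ?thesis by (simp add: l2_norm_def)
qed

lemma l2_norm_triangle:
  assumes a: "square_integrable M a" and b: "square_integrable M b"
  shows "l2_norm M (\<lambda>x. a x + b x) \<le> l2_norm M a + l2_norm M b"
proof -
  have "(l2_norm M (\<lambda>x. a x + b x))\<^sup>2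
      \<le> (\<integral>x. (cmod (a x))\<^sup>2 + 2 * (cmod (a x) * cmod (b x)) + (cmod (b x))\<^sup>2 \<partial>M)"
    unfolding l2_norm_power2
  proof (rule integral_mono)
    show "integrable M (\<lambda>x. (cmod (a x + b x))\<^sup>2)"
      by (intro square_integrable_integrable_norm_power2 square_integrable_add a b)
    show "integrable M (\<lambda>x. (cmod (a x))\<^sup>2 + 2 * (cmod (a x) * cmod (b x)) + (cmod (b x))\<^sup>2)"
      using a b integrable_norm_mult[OF a b] by (simp add: square_integrable_def)
    fix x
    have "(cmod (a x + b x))\<^sup>2 \<le> (cmod (a x) + cmod (b x))\<^sup>2"
      by (intro power_mono norm_triangle_ineq) auto
    then show "(cmod (a x + b x))\<^sup>2 \<le> (cmod (a x))\<^sup>2 + 2 * (cmod (a x) * cmod (b x)) + (cmod (b x))\<^sup>2"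
      by (simp add: power2_sum algebra_simps)
  qed
  also have "\<dots> = (l2_norm M a)\<^sup>2 + 2 * (\<integral>x. cmod (a x) * cmod (b x) \<partial>M) + (l2_norm M b)\<^sup>2"
    using a b integrable_norm_mult[OF a b] by (simp add: l2_norm_power2 square_integrable_def)
  also have "\<dots> \<le> (l2_norm M a + l2_norm M b)\<^sup>2"
    using Cauchy_Schwarz_integral_norm[OF a b] by (simp add: power2_sum)
  finally show ?thesis
    by (rule power2_le_imp_le) simp
qed

lemma l2_norm_triangle_diff:
  assumes "square_integrable M a" "square_integrable M b" "square_integrable M c"
  shows "l2_norm M (\<lambda>x. a x - c x) \<le> l2_norm M (\<lambda>x. a x - b x) + l2_norm M (\<lambda>x. b x - c x)"
  using l2_norm_triangle[of M "\<lambda>x. a x - b x" "\<lambda>x. b x - c x"] assms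
  by (simp add: square_integrable_diff)

lemma (in prob_space) l2_norm_bounded:
  assumes "b \<in> borel_measurable M" "AE x in M. cmod (b x) \<le> C" "0 \<le> C"
  shows "l2_norm M b \<le> C"
  using l2_norm_AE_le[OF square_integrable_const[of 1] assms(1,3)] assms(2)
  by (simp add: l2_norm_def prob_space)

lemma
  assumes [measurable]: "s \<in> borel_measurable M" "\<And>k. square_integrable M (S k)"
    and bounded: "\<And>k. l2_norm M (S k) \<le> K"
    and lim: "AE x in M. (\<lambda>k. S k x) \<longlonglongrightarrow> s x"
  shows square_integrable_Fatou: "square_integrable M s" and l2_norm_Fatou: "l2_norm M s \<le> K"
proof -
  have K: "0 \<le> K"
    using bounded[of 0] l2_norm_nonneg[of M "S 0"] by linarith
  have "(\<integral>\<^sup>+x. ennreal ((cmod (S k x))\<^sup>2) \<partial>M) \<le> ennreal (K\<^sup>2)" for k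
  proof -
    have "(\<integral>\<^sup>+x. ennreal ((cmod (S k x))\<^sup>2) \<partial>M) = ennreal ((l2_norm M (S k))\<^sup>2)"
      unfolding l2_norm_power2 using assms(2)
      by (intro nn_integral_eq_integral square_integrable_integrable_norm_power2) auto
    then show ?thesis
      using bounded[of k] by (simp add: power_mono)
  qed
  then have "liminf (\<lambda>k. \<integral>\<^sup>+x. ennreal ((cmod (S k x))\<^sup>2) \<partial>M) \<le> ennreal (K\<^sup>2)"
    by (intro Liminf_le) simp_all
  moreover have "(\<integral>\<^sup>+x. ennreal ((cmod (s x))\<^sup>2) \<partial>M) = (\<integral>\<^sup>+x. liminf (\<lambda>k. ennreal ((cmod (S k x))\<^sup>2)) \<partial>M)"
    using lim by (intro nn_integral_cong_AE, eventually_elim)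
      (auto intro!: lim_imp_Liminf[symmetric] tendsto_intros)
  moreover have "\<dots> \<le> liminf (\<lambda>k. \<integral>\<^sup>+x. ennreal ((cmod (S k x))\<^sup>2) \<partial>M)"
    by (rule nn_integral_liminf) measurable
  ultimately have nn_bounded: "(\<integral>\<^sup>+x. ennreal ((cmod (s x))\<^sup>2) \<partial>M) \<le> ennreal (K\<^sup>2)"
    by simp
  also have "\<dots> < \<infinity>" by simp
  finally show s: "square_integrable M s"
    by (auto simp: square_integrable_def intro!: integrableI_bounded)
  then have "(\<integral>\<^sup>+x. ennreal ((cmod (s x))\<^sup>2) \<partial>M) = ennreal ((l2_norm M s)\<^sup>2)"
    unfolding l2_norm_power2
    by (intro nn_integral_eq_integral square_integrable_integrable_norm_power2) auto
  then have "(l2_norm M s)\<^sup>2 \<le> K\<^sup>2"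
    using nn_bounded by simp
  then show "l2_norm M s \<le> K"
    using K by (rule power2_le_imp_le)
qed

lemma (in finite_measure) l2_Cauchy_AE_Cauchy_subseq:
  fixes S :: "nat \<Rightarrow> 'a \<Rightarrow> complex"
  assumes S: "\<And>n. square_integrable M (S n)"
    and Cauchy: "\<And>e. 0 < e \<Longrightarrow> \<exists>N. \<forall>i\<ge>N. \<forall>j\<ge>N. l2_norm M (\<lambda>x. S i x - S j x) < e"
  obtains r where "strict_mono r" "AE x in M. Cauchy (\<lambda>k. S (r k) x)"
proof (rule cauchy_L1_AE_cauchy_subseq[where s=S, OF integrable_of_square_integrable[OF S]])
  define C where "C = sqrt (measure M (space M)) + 1"
  have C: "sqrt (measure M (space M)) \<le> C" "0 < C" by (simp_all add: C_def add_nonneg_pos)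
  show "\<exists>N. \<forall>i\<ge>N. \<forall>j\<ge>N. (\<integral>x. cmod (S i x - S j x) \<partial>M) < e" if e: "0 < e" for e
  proof -
    obtain N where N: "\<And>i j. N \<le> i \<Longrightarrow> N \<le> j \<Longrightarrow> l2_norm M (\<lambda>x. S i x - S j x) < e / C"
      using Cauchy[of "e / C"] e C by auto
    have "(\<integral>x. cmod (S i x - S j x) \<partial>M) < e" if "N \<le> i" "N \<le> j" for i j
    proof -
      have "(\<integral>x. cmod (S i x - S j x) \<partial>M) \<le> l2_norm M (\<lambda>x. S i x - S j x) * sqrt (measure M (space M))"
        by (intro integral_norm_le_l2_norm square_integrable_diff S)
      also have "\<dots> \<le> l2_norm M (\<lambda>x. S i x - S j x) * C"
        by (intro mult_left_mono C) simp
      also have "\<dots> < e"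
        using N[OF that] C by (simp add: pos_less_divide_eq)
      finally show ?thesis .
    qed
    then show ?thesis by blast
  qed
qed (rule that)

lemma
  fixes S :: "nat \<Rightarrow> 'a \<Rightarrow> complex"
  assumes S: "\<And>n. square_integrable M (S n)" and [measurable]: "s \<in> borel_measurable M"
    and r: "strict_mono r" and lim: "AE x in M. (\<lambda>k. S (r k) x) \<longlonglongrightarrow> s x"
    and close: "\<And>i. N \<le> i \<Longrightarrow> l2_norm M (\<lambda>x. S n x - S i x) \<le> e"
  shows square_integrable_diff_subseq_limit: "square_integrable M (\<lambda>x. S n x - s x)"
    and l2_norm_diff_subseq_limit_le: "l2_norm M (\<lambda>x. S n x - s x) \<le> e"
proof -
  note [measurable] = S
  have "N \<le> r (k + N)" for k
    using seq_suble[OF r, of "k + N"] by simp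
  then have close_subseq: "l2_norm M (\<lambda>x. S n x - S (r (k + N)) x) \<le> e" for k
    by (rule close)
  have lim_diff: "AE x in M. (\<lambda>k. S n x - S (r (k + N)) x) \<longlonglongrightarrow> S n x - s x"
    using lim by eventually_elim (intro tendsto_diff tendsto_const LIMSEQ_ignore_initial_segment)
  show "square_integrable M (\<lambda>x. S n x - s x)"
    by (rule square_integrable_Fatou[OF _ square_integrable_diff close_subseq lim_diff]) (auto intro: S)
  show "l2_norm M (\<lambda>x. S n x - s x) \<le> e"
    by (rule l2_norm_Fatou[OF _ square_integrable_diff close_subseq lim_diff]) (auto intro: S)
qed

text \<open>The limit is taken pointwise: if every \<open>S n t\<close> is a function of \<open>circ t\<close>, then so is the limit.\<close>
lemma (in finite_measure) l2_Cauchy_limit: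
  fixes S :: "nat \<Rightarrow> 'a \<Rightarrow> complex"
  assumes S: "\<And>n. square_integrable M (S n)"
    and Cauchy: "\<And>e. 0 < e \<Longrightarrow> \<exists>N. \<forall>i\<ge>N. \<forall>j\<ge>N. l2_norm M (\<lambda>x. S i x - S j x) < e"
  obtains r where "strict_mono r" "square_integrable M (\<lambda>x. lim (\<lambda>k. S (r k) x))"
    "(\<lambda>n. l2_norm M (\<lambda>x. S n x - lim (\<lambda>k. S (r k) x))) \<longlonglongrightarrow> 0"
proof -
  note [measurable] = S
  obtain r where r: "strict_mono r" and AE_Cauchy: "AE x in M. Cauchy (\<lambda>k. S (r k) x)"
    using l2_Cauchy_AE_Cauchy_subseq[of S] S Cauchy by blast
  define s where "s x = lim (\<lambda>k. S (r k) x)" for x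
  have s: "s \<in> borel_measurable M"
    unfolding s_def by measurable
  have lim: "AE x in M. (\<lambda>k. S (r k) x) \<longlonglongrightarrow> s x"
    using AE_Cauchy by eventually_elim (simp add: s_def Cauchy_convergent_iff convergent_LIMSEQ_iff)
  have close: "\<exists>N. \<forall>n\<ge>N. \<forall>i\<ge>N. l2_norm M (\<lambda>x. S n x - S i x) \<le> e" if "0 < e" for e
    using Cauchy[OF that] by (meson less_imp_le)
  obtain N where "\<And>i. N \<le> i \<Longrightarrow> l2_norm M (\<lambda>x. S N x - S i x) \<le> 1"
    using close[of 1] by auto
  from square_integrable_diff[OF S[of N] square_integrable_diff_subseq_limit[OF S s r lim this]]
  have "square_integrable M s" by simp
  moreover have "(\<lambda>n. l2_norm M (\<lambda>x. S n x - s x)) \<longlonglongrightarrow> 0"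
  proof (rule LIMSEQ_I)
    fix e :: real assume "0 < e"
    then obtain N where "\<And>n i. N \<le> n \<Longrightarrow> N \<le> i \<Longrightarrow> l2_norm M (\<lambda>x. S n x - S i x) \<le> e / 2"
      using close[of "e / 2"] by auto
    then have "\<And>n. N \<le> n \<Longrightarrow> l2_norm M (\<lambda>x. S n x - s x) \<le> e / 2"
      by (rule l2_norm_diff_subseq_limit_le[OF S s r lim])
    then show "\<exists>N. \<forall>n\<ge>N. norm (l2_norm M (\<lambda>x. S n x - s x) - 0) < e"
      using \<open>0 < e\<close> by (intro exI[of _ N]) fastforce
  qed
  ultimately show ?thesis
    using r unfolding s_def by (intro that)
qed

section \<open>Orthonormal families\<close>

definition orthonormal_family :: "'a measure \<Rightarrow> ('i \<Rightarrow> 'a \<Rightarrow> complex) \<Rightarrow> bool" where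
  "orthonormal_family M e \<longleftrightarrow>
     (\<forall>i. square_integrable M (e i)) \<and> (\<forall>i j. l2_inner M (e i) (e j) = (if i = j then 1 else 0))"

lemma orthonormal_family_square_integrable_sum:
  "orthonormal_family M e \<Longrightarrow> square_integrable M (\<lambda>x. \<Sum>i\<in>A. c i * e i x)"
  by (intro square_integrable_sum square_integrable_cmult) (simp add: orthonormal_family_def)

lemma l2_inner_orthonormal_sum_left:
  assumes "orthonormal_family M e" "finite A"
  shows "l2_inner M (\<lambda>x. \<Sum>i\<in>A. c i * e i x) (e j) = (if j \<in> A then c j else 0)"
proof -
  have e: "square_integrable M (e i)" "l2_inner M (e i) (e j) = (if i = j then 1 else 0)" for i
    using assms(1) by (auto simp: orthonormal_family_def)
  show ?thesis
    using assms(2)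
    by (subst l2_inner_sum_left)
       (auto simp: e l2_inner_cmult_left if_distrib intro!: square_integrable_cmult cong: if_cong)
qed

lemma l2_inner_orthonormal_sum_right:
  assumes "orthonormal_family M e" "square_integrable M q"
  shows "l2_inner M q (\<lambda>x. \<Sum>i\<in>A. c i * e i x) = (\<Sum>i\<in>A. cnj (c i) * l2_inner M q (e i))"
  using assms
  by (subst l2_inner_sum_right)
     (auto simp: orthonormal_family_def l2_inner_cmult_right intro: square_integrable_cmult)

lemma l2_norm_orthonormal_sum:
  assumes e: "orthonormal_family M e" and A: "finite A"
  shows "(l2_norm M (\<lambda>x. \<Sum>i\<in>A. c i * e i x))\<^sup>2 = (\<Sum>i\<in>A. (cmod (c i))\<^sup>2)"
proof -
  let ?S = "\<lambda>x. \<Sum>i\<in>A. c i * e i x"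
  have "complex_of_real ((l2_norm M ?S)\<^sup>2) = (\<Sum>i\<in>A. cnj (c i) * l2_inner M ?S (e i))"
    unfolding l2_inner_self[symmetric]
    by (rule l2_inner_orthonormal_sum_right[OF e orthonormal_family_square_integrable_sum[OF e]])
  also have "\<dots> = of_real (\<Sum>i\<in>A. (cmod (c i))\<^sup>2)"
    by (simp add: l2_inner_orthonormal_sum_left[OF assms] complex_norm_square[unfolded of_real_power]
        mult.commute)
  finally show ?thesis
    unfolding of_real_eq_iff .
qed

lemma Bessel_inequality:
  assumes e: "orthonormal_family M e" and q: "square_integrable M q" and A: "finite A"
  shows "(\<Sum>i\<in>A. (cmod (l2_inner M q (e i)))\<^sup>2) \<le> (l2_norm M q)\<^sup>2"
proof -
  define S where "S x = (\<Sum>i\<in>A. l2_inner M q (e i) * e i x)" for x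
  have S: "square_integrable M S"
    unfolding S_def by (rule orthonormal_family_square_integrable_sum[OF e])
  have norm_S: "(l2_norm M S)\<^sup>2 = (\<Sum>i\<in>A. (cmod (l2_inner M q (e i)))\<^sup>2)"
    unfolding S_def by (rule l2_norm_orthonormal_sum[OF e A])
  have "l2_inner M q S = of_real ((l2_norm M S)\<^sup>2)"
    unfolding norm_S unfolding S_def l2_inner_orthonormal_sum_right[OF e q]
    by (simp add: complex_norm_square[unfolded of_real_power] mult.commute)
  then have "(l2_norm M S)\<^sup>2 \<le> l2_norm M q * l2_norm M S"
    using norm_l2_inner_le[OF q S] by (simp add: norm_power)
  then have "l2_norm M S \<le> l2_norm M q"
    by (cases "l2_norm M S = 0") (auto simp: power2_eq_square mult_le_cancel_right less_le)
  then have "(l2_norm M S)\<^sup>2 \<le> (l2_norm M q)\<^sup>2"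
    by (intro power_mono) auto
  then show ?thesis
    unfolding norm_S .
qed

lemma norm_l2_inner_orthonormal_le:
  assumes "orthonormal_family M e" "square_integrable M q"
  shows "cmod (l2_inner M q (e i)) \<le> l2_norm M q"
  using Bessel_inequality[OF assms, of "{i}"] by (simp add: power2_le_iff_abs_le)

lemma orthonormal_partial_sums_Cauchy:
  fixes e :: "nat \<Rightarrow> 'a \<Rightarrow> complex"
  assumes e: "orthonormal_family M e" and c: "summable (\<lambda>n. (cmod (c n))\<^sup>2)" and \<epsilon>: "0 < \<epsilon>"
  shows "\<exists>N. \<forall>i\<ge>N. \<forall>j\<ge>N. l2_norm M (\<lambda>x. (\<Sum>n<i. c n * e n x) - (\<Sum>n<j. c n * e n x)) < \<epsilon>"
proof -
  let ?S = "\<lambda>m x. \<Sum>n<m. c n * e n x"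
  obtain N where N: "\<And>m n. N \<le> m \<Longrightarrow> (\<Sum>i=m..<n. (cmod (c i))\<^sup>2) < \<epsilon>\<^sup>2"
    using c \<epsilon> unfolding summable_Cauchy by (fastforce simp: abs_of_nonneg sum_nonneg)
  have close_ordered: "l2_norm M (\<lambda>x. ?S n x - ?S m x) < \<epsilon>" if "N \<le> m" "m \<le> n" for m n
  proof -
    have "(l2_norm M (\<lambda>x. ?S n x - ?S m x))\<^sup>2 = (\<Sum>i=m..<n. (cmod (c i))\<^sup>2)"
      using l2_norm_orthonormal_sum[OF e, of "{m..<n}" c] that
      by (simp add: sum_diff_nat_ivl lessThan_atLeast0)
    then show ?thesis
      using N[OF that(1)] \<epsilon> by (intro power2_less_imp_less[of _ \<epsilon>]) auto
  qed
  have "l2_norm M (\<lambda>x. ?S i x - ?S j x) < \<epsilon>" if "N \<le> i" "N \<le> j" for i j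
    using close_ordered[of i j] close_ordered[of j i] that l2_norm_minus_commute[of M "?S i" "?S j"]
    by (cases "i \<le> j") auto
  then show ?thesis by blast
qed

lemma (in finite_measure) Riesz_Fischer:
  fixes e :: "nat \<Rightarrow> 'a \<Rightarrow> complex"
  assumes e: "orthonormal_family M e" and c: "summable (\<lambda>n. (cmod (c n))\<^sup>2)"
  obtains r where "square_integrable M (\<lambda>x. lim (\<lambda>k. \<Sum>n<r k. c n * e n x))"
    "(\<lambda>m. l2_norm M (\<lambda>x. (\<Sum>n<m. c n * e n x) - lim (\<lambda>k. \<Sum>n<r k. c n * e n x))) \<longlonglongrightarrow> 0"
    "\<And>n. l2_inner M (\<lambda>x. lim (\<lambda>k. \<Sum>n<r k. c n * e n x)) (e n) = c n"
proof -
  define S where "S m x = (\<Sum>n<m. c n * e n x)" for m x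
  have S: "square_integrable M (S m)" for m
    unfolding S_def by (rule orthonormal_family_square_integrable_sum[OF e])
  have "\<exists>N. \<forall>i\<ge>N. \<forall>j\<ge>N. l2_norm M (\<lambda>x. S i x - S j x) < \<epsilon>" if "0 < \<epsilon>" for \<epsilon>
    unfolding S_def by (rule orthonormal_partial_sums_Cauchy[OF e c that])
  from l2_Cauchy_limit[OF S this] obtain r where s: "square_integrable M (\<lambda>x. lim (\<lambda>k. S (r k) x))"
    and lim: "(\<lambda>m. l2_norm M (\<lambda>x. S m x - lim (\<lambda>k. S (r k) x))) \<longlonglongrightarrow> 0"
    by blast
  have "l2_inner M (\<lambda>x. lim (\<lambda>k. S (r k) x)) (e n) = c n" for n
  proof (rule LIMSEQ_unique)
    show "(\<lambda>m. l2_inner M (S m) (e n)) \<longlonglongrightarrow> l2_inner M (\<lambda>x. lim (\<lambda>k. S (r k) x)) (e n)"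
      using e by (intro tendsto_l2_inner_left S s lim) (simp add: orthonormal_family_def)
    have "l2_inner M (S m) (e n) = c n" if "Suc n \<le> m" for m
      using that unfolding S_def by (simp add: l2_inner_orthonormal_sum_left[OF e])
    then show "(\<lambda>m. l2_inner M (S m) (e n)) \<longlonglongrightarrow> c n"
      by (intro tendsto_eventually eventually_sequentiallyI[of "Suc n"])
  qed
  then show ?thesis
    using s lim unfolding S_def by (intro that)
qed

section \<open>The unit circle\<close>

abbreviation unit_lborel :: "real measure" where
  "unit_lborel \<equiv> restrict_space lborel {0..1}"

lemma space_unit_lborel [simp]: "space unit_lborel = {0..1}"
  by (simp add: space_restrict_space)

interpretation unit_lborel: prob_space unit_lborel
  by standard (simp add: emeasure_restrict_space)

lemma AE_unit_lborel: "(AE t in unit_lborel. P t) \<longleftrightarrow> (AE t in lborel. t \<in> {0..1} \<longrightarrow> P t)"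
  by (simp add: AE_restrict_space_iff)

lemma set_integrable_unit_lborel:
  fixes F :: "real \<Rightarrow> 'b::{banach, second_countable_topology}"
  shows "set_integrable lborel {0..1} F \<longleftrightarrow> integrable unit_lborel F"
  by (simp add: set_integrable_def integrable_restrict_space)

lemma set_integral_unit_lborel:
  fixes F :: "real \<Rightarrow> 'b::{banach, second_countable_topology}"
  shows "(LINT t:{0..1}|lborel. F t) = (\<integral>t. F t \<partial>unit_lborel)"
  by (simp add: set_lebesgue_integral_def integral_restrict_space)

lemma measurable_unit_lborel: "F \<in> borel_measurable borel \<Longrightarrow> F \<in> borel_measurable unit_lborel"
  by (rule measurable_restrict_space1) simp

lemma norm_circ [simp]: "cmod (circ t) = 1"
  by (simp add: circ_def)

lemma continuous_on_circ [continuous_intros]: "continuous_on S circ"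
  unfolding circ_def by (intro continuous_intros)

lemma measurable_compose_circ:
  fixes F :: "complex \<Rightarrow> 'b::topological_space"
  assumes "continuous_on (sphere 0 1) F"
  shows "(\<lambda>t. F (circ t)) \<in> borel_measurable borel"
  by (rule borel_measurable_continuous_onI, rule continuous_on_compose2[OF assms])
     (auto intro: continuous_intros)

lemma continuous_on_circle_bounded:
  assumes "continuous_on (sphere 0 1) F"
  obtains B where "0 < B" "\<And>z. cmod z = 1 \<Longrightarrow> cmod (F z) \<le> B"
proof -
  have "bounded (F ` sphere 0 1)"
    by (intro compact_imp_bounded compact_continuous_image assms) simp
  then show ?thesis
    using that by (auto simp: bounded_pos)
qed

lemma square_integrable_circ:
  assumes "continuous_on (sphere 0 1) F"
  shows "square_integrable unit_lborel (\<lambda>t. F (circ t))"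
proof -
  obtain B where "\<And>z. cmod z = 1 \<Longrightarrow> cmod (F z) \<le> B"
    using continuous_on_circle_bounded[OF assms] by blast
  then show ?thesis
    by (intro unit_lborel.square_integrable_bounded[where C=B] measurable_unit_lborel
        measurable_compose_circ assms) auto
qed

lemma integrable_circ:
  fixes F :: "complex \<Rightarrow> complex"
  assumes "continuous_on (sphere 0 1) F"
  shows "integrable unit_lborel (\<lambda>t. F (circ t))"
  by (intro unit_lborel.integrable_of_square_integrable square_integrable_circ assms)

lemma integral_circ_mean_value:
  assumes cont: "continuous_on (cball 0 1) f" and holo: "f holomorphic_on ball 0 1"
  shows "(\<integral>t. f (circ t) \<partial>unit_lborel) = f 0"
proof -
  have circlepath: "circlepath 0 1 = circ"
    by (auto simp: circlepath circ_def cis_conv_exp mult_ac)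
  have deriv: "vector_derivative circ (at t within {0..1}) = 2 * of_real pi * \<i> * circ t" if "t \<in> {0..1}" for t
    using vector_derivative_circlepath01[of t 0 1] that
    by (simp add: circlepath) (simp add: circ_def cis_conv_exp mult_ac)
  have "((\<lambda>u. f u / (u - 0)) has_contour_integral (2 * of_real pi * \<i> * f 0)) circ"
    using Cauchy_integral_circlepath[OF cont holo, of 0] unfolding circlepath by simp
  then have "((\<lambda>t. 2 * of_real pi * \<i> * f (circ t)) has_integral 2 * of_real pi * \<i> * f 0) {0..1}"
    unfolding has_contour_integral_def
  proof (rule has_integral_eq[rotated])
    show "f (circ t) / (circ t - 0) * vector_derivative circ (at t within {0..1})
        = 2 * of_real pi * \<i> * f (circ t)"
      if "t \<in> {0..1}" for t
    proof -
      have "circ t \<noteq> 0" using norm_circ[of t] by fastforce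
      then show ?thesis by (simp add: deriv[OF that])
    qed
  qed
  from has_integral_mult_right[OF this, of "1 / (2 * of_real pi * \<i>)"]
  have "((\<lambda>t. f (circ t)) has_integral f 0) {0..1}"
    by simp
  moreover have "integrable unit_lborel (\<lambda>t. f (circ t))"
    by (intro integrable_circ continuous_on_subset[OF cont]) auto
  then have "(\<integral>t. f (circ t) \<partial>unit_lborel) = integral {0..1} (\<lambda>t. f (circ t))"
    using set_borel_integral_eq_integral(2)[of "{0..1}" "\<lambda>t. f (circ t)"]
    by (simp add: set_integrable_unit_lborel set_integral_unit_lborel)
  ultimately show ?thesis
    by (simp add: integral_unique)
qed

abbreviation circ_power :: "nat \<Rightarrow> real \<Rightarrow> complex" where
  "circ_power n \<equiv> \<lambda>t. circ t ^ n"

lemma square_integrable_circ_power [simp]: "square_integrable unit_lborel (circ_power n)"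
  by (rule square_integrable_circ) (intro continuous_intros)

lemma square_integrable_poly_circ [simp]: "square_integrable unit_lborel (\<lambda>t. poly P (circ t))"
  by (rule square_integrable_circ) (intro continuous_intros)

lemma circ_power_mult_cnj_circ_power:
  assumes "j \<le> i"
  shows "circ t ^ i * cnj (circ t ^ j) = circ t ^ (i - j)"
proof -
  have "circ t ^ i = circ t ^ (i - j) * circ t ^ j"
    using assms by (simp flip: power_add)
  then have "circ t ^ i * cnj (circ t ^ j) = circ t ^ (i - j) * complex_of_real ((cmod (circ t ^ j))\<^sup>2)"
    by (simp only: complex_norm_square mult.assoc)
  then show ?thesis
    by (simp add: norm_power)
qed

lemma orthonormal_circ_power: "orthonormal_family unit_lborel circ_power"
  unfolding orthonormal_family_def
proof (intro conjI allI)
  have ordered: "l2_inner unit_lborel (circ_power i) (circ_power j) = (if i = j then 1 else 0)"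
    if "j \<le> i" for i j
  proof -
    have "l2_inner unit_lborel (circ_power i) (circ_power j) = (\<integral>t. circ t ^ (i - j) \<partial>unit_lborel)"
      unfolding l2_inner_def circ_power_mult_cnj_circ_power[OF that] ..
    also have "\<dots> = 0 ^ (i - j)"
      by (rule integral_circ_mean_value) (auto intro: continuous_intros holomorphic_intros)
    finally show ?thesis
      using that by (simp add: power_0_left)
  qed
  show "l2_inner unit_lborel (circ_power i) (circ_power j) = (if i = j then 1 else 0)" for i j
    using ordered[of i j] ordered[of j i] cnj_l2_inner[of unit_lborel "circ_power j" "circ_power i"]
    by (cases "j \<le> i") auto
qed simp

abbreviation fourier_coeff :: "(real \<Rightarrow> complex) \<Rightarrow> nat \<Rightarrow> complex" where
  "fourier_coeff b n \<equiv> l2_inner unit_lborel b (circ_power n)"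

abbreviation neg_fourier_coeff :: "(real \<Rightarrow> complex) \<Rightarrow> nat \<Rightarrow> complex" where
  "neg_fourier_coeff b n \<equiv> l2_inner unit_lborel b (\<lambda>t. cnj (circ t ^ n))"

lemma fourier_coeff_poly: "fourier_coeff (\<lambda>t. poly P (circ t)) n = coeff P n"
  unfolding poly_altdef
  by (subst l2_inner_orthonormal_sum_left[OF orthonormal_circ_power]) (auto simp: coeff_eq_0)

lemma l2_inner_poly_circ_eq_0:
  assumes "square_integrable unit_lborel q"
    and "\<And>n. fourier_coeff q n = 0"
  shows "l2_inner unit_lborel q (\<lambda>t. poly P (circ t)) = 0"
  unfolding poly_altdef
  by (subst l2_inner_orthonormal_sum_right[OF orthonormal_circ_power assms(1)]) (simp add: assms(2))

lemma neg_fourier_coeff_poly: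
  "neg_fourier_coeff (\<lambda>t. poly P (circ t)) (Suc n) = 0"
proof -
  have "(\<integral>t. poly P (circ t) * circ t ^ Suc n \<partial>unit_lborel) = poly P 0 * 0 ^ Suc n"
    by (rule integral_circ_mean_value) (intro continuous_intros holomorphic_intros)+
  then show ?thesis
    by (simp add: l2_inner_def)
qed

section \<open>Density of trigonometric polynomials\<close>

lemma continuous_on_circle_loop:
  fixes h :: "real \<Rightarrow> 'a::real_normed_vector"
  assumes "continuous_on {0..1} h" "h 0 = h 1"
  shows "continuous_on (sphere 0 1) (\<lambda>z. h (Arg2pi z / (2 * pi)))"
proof -
  have "homotopic_loops UNIV h h"
    using assms by (simp add: homotopic_loops_refl path_def pathstart_def pathfinish_def)
  then show ?thesis
    using homotopic_loops_imp_homotopic_circlemaps[of UNIV h h] homotopic_with_imp_continuous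
    by (fastforce simp: o_def)
qed

lemma Arg2pi_circ:
  assumes "0 \<le> t" "t < 1"
  shows "Arg2pi (circ t) / (2 * pi) = t"
proof -
  have "Arg2pi (circ t) = 2 * pi * t"
    by (rule Arg2pi_unique[of 1]) (use assms in \<open>auto simp: circ_def cis_conv_exp\<close>)
  then show ?thesis by simp
qed

lemma Re_poly_mult_cnj_poly:
  "\<exists>S. \<forall>z. cmod z = 1 \<longrightarrow> Re (poly P z * cnj (poly Q z)) = Re (poly S z)"
proof (induction P Q rule: poly_induct2)
  case 0
  show ?case by (intro exI[of _ 0]) simp
next
  case (pCons a P b Q)
  then obtain S where S: "\<And>z. cmod z = 1 \<Longrightarrow> Re (poly P z * cnj (poly Q z)) = Re (poly S z)"
    by blast
  define R where "R = smult (cnj a) (pCons b Q) + smult (cnj b) (pCons 0 P) + S"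
  have "Re (poly (pCons a P) z * cnj (poly (pCons b Q) z)) = Re (poly R z)" if z: "cmod z = 1" for z
  proof -
    have z_cnj: "z * cnj z = 1"
      using z complex_norm_square[of z] by simp
    have "poly (pCons a P) z * cnj (poly (pCons b Q) z)
      = cnj (cnj a * poly (pCons b Q) z) + cnj b * poly (pCons 0 P) z
        + (z * cnj z) * (poly P z * cnj (poly Q z))"
      by (simp add: algebra_simps)
    then have "Re (poly (pCons a P) z * cnj (poly (pCons b Q) z))
      = Re (cnj a * poly (pCons b Q) z) + Re (cnj b * poly (pCons 0 P) z) + Re (poly S z)"
      unfolding z_cnj by (simp only: plus_complex.simps complex_cnj mult_1 S[OF z] cnj.simps)
    then show ?thesis unfolding R_def poly_add poly_smult plus_complex.simps .
  qed
  then show ?case by blast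
qed

lemma real_polynomial_function_circle:
  assumes "real_polynomial_function p"
  shows "\<exists>P. \<forall>z::complex. cmod z = 1 \<longrightarrow> p z = Re (poly P z)"
  using assms
proof (induction rule: real_polynomial_function.induct)
  case (linear f)
  interpret bounded_linear f by fact
  have "f z = Re (poly [:0, Complex (f 1) (- f \<i>):] z)" for z
  proof -
    have "f z = f (Re z *\<^sub>R 1 + Im z *\<^sub>R \<i>)"
      by (rule arg_cong[where f=f]) (simp add: complex_eq_iff)
    also have "\<dots> = Re z * f 1 + Im z * f \<i>"
      by (simp only: add scaleR real_scaleR_def)
    finally show ?thesis by simp
  qed
  then show ?case by blast
next
  case (const c)
  show ?case by (intro exI[of _ "[:of_real c:]"]) simp
next
  case (add p q)
  then obtain P Q where "\<And>z. cmod z = 1 \<Longrightarrow> p z = Re (poly P z)" "\<And>z. cmod z = 1 \<Longrightarrow> q z = Re (poly Q z)"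
    by blast
  then show ?case by (intro exI[of _ "P + Q"]) simp
next
  case (mult p q)
  then obtain P Q where PQ: "\<And>z. cmod z = 1 \<Longrightarrow> p z = Re (poly P z)"
      "\<And>z. cmod z = 1 \<Longrightarrow> q z = Re (poly Q z)"
    by blast
  obtain S where S: "\<And>z. cmod z = 1 \<Longrightarrow> Re (poly P z * cnj (poly Q z)) = Re (poly S z)"
    using Re_poly_mult_cnj_poly by blast
  have "p z * q z = Re (poly (smult (1/2) (P * Q + S)) z)" if z: "cmod z = 1" for z
  proof -
    have "p z * q z = (Re (poly P z * poly Q z) + Re (poly P z * cnj (poly Q z))) / 2"
      by (simp add: PQ[OF z])
    also have "\<dots> = Re (poly (smult (1/2) (P * Q + S)) z)"
      by (simp add: S[OF z] del: cnj.simps times_complex.sel)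
    finally show ?thesis .
  qed
  then show ?case by blast
qed

lemma Stone_Weierstrass_circle:
  fixes H :: "complex \<Rightarrow> real"
  assumes "continuous_on (sphere 0 1) H" "0 < e"
  obtains P where "\<And>z. cmod z = 1 \<Longrightarrow> \<bar>H z - Re (poly P z)\<bar> < e"
proof -
  obtain p where "real_polynomial_function p" "\<And>z. z \<in> sphere 0 1 \<Longrightarrow> \<bar>H z - p z\<bar> < e"
    using Stone_Weierstrass_real_polynomial_function[OF _ assms] by auto
  moreover obtain P where "\<And>z. cmod z = 1 \<Longrightarrow> p z = Re (poly P z)"
    using real_polynomial_function_circle[OF calculation(1)] by blast
  ultimately show ?thesis
    by (intro that[of P]) force
qed

lemma Stone_Weierstrass_circle_between:
  fixes H :: "complex \<Rightarrow> real"
  assumes H: "continuous_on (sphere 0 1) H" "\<And>z. a \<le> H z" "\<And>z. H z \<le> b" and ab: "a < b" and e: "0 < e"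
  obtains P where "\<And>z. cmod z = 1 \<Longrightarrow> a \<le> Re (poly P z) \<and> Re (poly P z) \<le> b"
    "\<And>z. cmod z = 1 \<Longrightarrow> \<bar>H z - Re (poly P z)\<bar> < e"
proof -
  define \<eta> where "\<eta> = min (e / 2) ((b - a) / 2)"
  have \<eta>: "0 < \<eta>" "2 * \<eta> \<le> e" "2 * \<eta> \<le> b - a"
    using ab e by (auto simp: \<eta>_def min_def)
  define K where "K z = max (a + \<eta>) (min (b - \<eta>) (H z))" for z
  have K: "a + \<eta> \<le> K z" "K z \<le> b - \<eta>" "\<bar>H z - K z\<bar> \<le> \<eta>" for z
    using \<eta> H(2,3)[of z] by (auto simp: K_def)
  have "continuous_on (sphere 0 1) K"
    unfolding K_def by (intro continuous_intros H)
  then obtain P where P: "\<And>z. cmod z = 1 \<Longrightarrow> \<bar>K z - Re (poly P z)\<bar> < \<eta>"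
    using Stone_Weierstrass_circle[OF _ \<eta>(1)] by blast
  have "a \<le> Re (poly P z) \<and> Re (poly P z) \<le> b" "\<bar>H z - Re (poly P z)\<bar> < e" if "cmod z = 1" for z
    using P[OF that] K[of z] \<eta> by auto
  then show ?thesis by (rule that)
qed

lemma measurable_AE_limit_continuous:
  fixes \<phi> :: "real \<Rightarrow> real"
  assumes \<phi>: "\<phi> \<in> borel_measurable unit_lborel"
  obtains g where "\<And>n. continuous_on UNIV (g n)" "AE t in unit_lborel. (\<lambda>n. g n t) \<longlonglongrightarrow> \<phi> t"
proof -
  have "(\<lambda>t. indicator {0..1} t * \<phi> t) \<in> borel_measurable lborel"
    using \<phi> borel_measurable_restrict_space_iff[of "{0..1}" lborel \<phi>] by simp
  then have "(\<lambda>t. indicator {0..1} t * \<phi> t) measurable_on UNIV"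
    by (intro lebesgue_measurable_imp_measurable_on_real measurable_completion) auto
  then obtain N g where N: "negligible N" and g: "\<And>n. continuous_on UNIV (g n)"
    and lim: "\<And>t. t \<notin> N \<Longrightarrow> (\<lambda>n. g n t) \<longlonglongrightarrow> indicator {0..1} t * \<phi> t"
    unfolding measurable_on_def by auto
  have "AE t in lebesgue. t \<notin> N"
    using N by (intro AE_not_in) (simp add: negligible_iff_null_sets)
  then have "AE t in lborel. t \<notin> N"
    by (simp add: AE_completion_iff)
  then have "AE t in unit_lborel. (\<lambda>n. g n t) \<longlonglongrightarrow> \<phi> t"
    unfolding AE_unit_lborel by eventually_elim (use lim in force)
  then show ?thesis
    using g by (intro that)
qed

lemma tendsto_min_1_of_nat_mult:
  fixes s :: real
  assumes "0 < s"
  shows "(\<lambda>n. min 1 (real n * s)) \<longlonglongrightarrow> 1"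
proof (rule tendsto_eventually)
  have "filterlim (\<lambda>n. real n * s) at_top sequentially"
    using assms by (intro filterlim_at_top_mult_tendsto_pos[OF tendsto_const] filterlim_real_sequentially)
  then have "\<forall>\<^sub>F n in sequentially. 1 \<le> real n * s"
    by (simp add: filterlim_at_top)
  then show "\<forall>\<^sub>F n in sequentially. min 1 (real n * s) = 1"
    by eventually_elim simp
qed

lemma measurable_AE_limit_continuous_loops:
  fixes \<phi> :: "real \<Rightarrow> real"
  assumes \<phi>: "\<phi> \<in> borel_measurable unit_lborel"
    and bounds: "AE t in unit_lborel. a \<le> \<phi> t \<and> \<phi> t \<le> b" and ab: "a \<le> b"
  obtains h where "\<And>n. continuous_on UNIV (h n)" "\<And>n. h n 0 = h n 1" "\<And>n t. a \<le> h n t" "\<And>n t. h n t \<le> b"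
    "AE t in unit_lborel. (\<lambda>n. h n t) \<longlonglongrightarrow> \<phi> t"
proof -
  obtain g where g: "\<And>n. continuous_on UNIV (g n)"
    and lim: "AE t in unit_lborel. (\<lambda>n. g n t) \<longlonglongrightarrow> \<phi> t"
    using measurable_AE_limit_continuous[OF \<phi>] by blast
  \<comment> \<open>The factor \<open>min 1 \<dots>\<close> vanishes at both endpoints, which makes \<open>h n\<close> a loop.\<close>
  define h where "h n t = max a (min b (min 1 (real n * min t (1 - t)) * g n t))" for n t
  have "AE t in unit_lborel. t \<noteq> 0 \<and> t \<noteq> 1 \<and> 0 \<le> t \<and> t \<le> 1"
    unfolding AE_unit_lborel using AE_lborel_singleton[of "0::real"] AE_lborel_singleton[of "1::real"]
    by eventually_elim auto
  with lim bounds have "AE t in unit_lborel. (\<lambda>n. h n t) \<longlonglongrightarrow> \<phi> t"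
  proof eventually_elim
    case (elim t)
    have "(\<lambda>n. min 1 (real n * min t (1 - t)) * g n t) \<longlonglongrightarrow> 1 * \<phi> t"
      using elim by (intro tendsto_mult tendsto_min_1_of_nat_mult) auto
    then have "(\<lambda>n. h n t) \<longlonglongrightarrow> max a (min b (1 * \<phi> t))"
      unfolding h_def by (intro tendsto_max tendsto_min tendsto_const)
    then show ?case
      using elim by simp
  qed
  moreover have "continuous_on UNIV (h n)" for n
    unfolding h_def by (intro continuous_intros g)
  moreover have "h n 0 = h n 1" "a \<le> h n t" "h n t \<le> b" for n t
    using ab by (simp_all add: h_def)
  ultimately show ?thesis
    by (intro that[of h])
qed

lemma continuous_loop_L1_approx:
  fixes \<phi> :: "real \<Rightarrow> real"
  assumes \<phi> [measurable]: "\<phi> \<in> borel_measurable unit_lborel"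
    and bounds: "AE t in unit_lborel. a \<le> \<phi> t \<and> \<phi> t \<le> b" and ab: "a \<le> b" and \<delta>: "0 < \<delta>"
  obtains h where "continuous_on UNIV h" "h 0 = h 1" "\<And>t. a \<le> h t" "\<And>t. h t \<le> b"
    "(\<integral>t. \<bar>\<phi> t - h t\<bar> \<partial>unit_lborel) < \<delta>"
proof -
  obtain h where cont: "\<And>n. continuous_on UNIV (h n)" and loop: "\<And>n. h n 0 = h n 1"
    and h: "\<And>n t. a \<le> h n t" "\<And>n t. h n t \<le> b"
    and lim: "AE t in unit_lborel. (\<lambda>n. h n t) \<longlonglongrightarrow> \<phi> t"
    using measurable_AE_limit_continuous_loops[OF \<phi> bounds ab] by blast
  have [measurable]: "h n \<in> borel_measurable unit_lborel" for n
    by (intro measurable_unit_lborel borel_measurable_continuous_onI cont)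
  have "(\<lambda>n. \<integral>t. \<bar>\<phi> t - h n t\<bar> \<partial>unit_lborel) \<longlonglongrightarrow> (\<integral>t. 0 \<partial>unit_lborel)"
  proof (rule integral_dominated_convergence[where w="\<lambda>_. b - a"])
    show "AE t in unit_lborel. (\<lambda>n. \<bar>\<phi> t - h n t\<bar>) \<longlonglongrightarrow> 0"
      using lim
    proof eventually_elim
      case (elim t)
      from tendsto_diff[OF tendsto_const[of "\<phi> t"] this] show ?case
        by (simp add: tendsto_rabs_zero_iff)
    qed
    show "AE t in unit_lborel. norm \<bar>\<phi> t - h n t\<bar> \<le> b - a" for n
      using bounds
    proof eventually_elim
      case (elim t)
      then show ?case using h[of n t] by (simp add: abs_le_iff)
    qed
  qed auto
  then have "\<forall>\<^sub>F n in sequentially. (\<integral>t. \<bar>\<phi> t - h n t\<bar> \<partial>unit_lborel) < \<delta>"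
    using \<delta> by (intro order_tendstoD) auto
  then obtain n where "(\<integral>t. \<bar>\<phi> t - h n t\<bar> \<partial>unit_lborel) < \<delta>"
    by (auto simp: eventually_sequentially)
  then show ?thesis
    using that[OF cont loop h] by blast
qed

lemma continuous_circle_L1_approx:
  fixes \<phi> :: "real \<Rightarrow> real"
  assumes "\<phi> \<in> borel_measurable unit_lborel"
    and "AE t in unit_lborel. a \<le> \<phi> t \<and> \<phi> t \<le> b" and "a \<le> b" and "0 < \<delta>"
  obtains H where "continuous_on (sphere 0 1) H" "\<And>z. a \<le> H z" "\<And>z. H z \<le> b"
    "(\<integral>t. \<bar>\<phi> t - H (circ t)\<bar> \<partial>unit_lborel) < \<delta>"
proof -
  obtain h where h: "continuous_on UNIV h" "h 0 = h 1" "\<And>t. a \<le> h t" "\<And>t. h t \<le> b"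
    and h_close: "(\<integral>t. \<bar>\<phi> t - h t\<bar> \<partial>unit_lborel) < \<delta>"
    using continuous_loop_L1_approx[OF assms] by blast
  define H where "H z = h (Arg2pi z / (2 * pi))" for z
  have "H (circ t) = h t" if "t \<in> {0..1}" for t
  proof (cases "t = 1")
    case True
    moreover have "Arg2pi 1 = 0" by (simp add: Arg2pi_eq_0)
    ultimately show ?thesis using h(2) by (simp add: H_def circ_def)
  next
    case False
    then show ?thesis using that by (simp add: H_def Arg2pi_circ)
  qed
  then have "(\<integral>t. \<bar>\<phi> t - H (circ t)\<bar> \<partial>unit_lborel) = (\<integral>t. \<bar>\<phi> t - h t\<bar> \<partial>unit_lborel)"
    by (intro Bochner_Integration.integral_cong) auto
  moreover have "continuous_on (sphere 0 1) H"
    unfolding H_def by (intro continuous_on_circle_loop continuous_on_subset[OF h(1)] h(2)) simp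
  ultimately show ?thesis
    using h h_close by (intro that[of H]) (auto simp: H_def)
qed

lemma Re_poly_L1_approx:
  fixes \<phi> :: "real \<Rightarrow> real"
  assumes \<phi>: "\<phi> \<in> borel_measurable unit_lborel"
    and bounds: "AE t in unit_lborel. a \<le> \<phi> t \<and> \<phi> t \<le> b" and ab: "a < b" and \<delta>: "0 < \<delta>"
  obtains P where "\<And>z. cmod z = 1 \<Longrightarrow> a \<le> Re (poly P z)" "\<And>z. cmod z = 1 \<Longrightarrow> Re (poly P z) \<le> b"
    "(\<integral>t. \<bar>\<phi> t - Re (poly P (circ t))\<bar> \<partial>unit_lborel) \<le> \<delta>"
proof -
  have half_pos: "0 < \<delta> / 2" using \<delta> by simp
  obtain H where H: "continuous_on (sphere 0 1) H" "\<And>z. a \<le> H z" "\<And>z. H z \<le> b"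
    and H_close: "(\<integral>t. \<bar>\<phi> t - H (circ t)\<bar> \<partial>unit_lborel) < \<delta> / 2"
    using continuous_circle_L1_approx[OF \<phi> bounds less_imp_le[OF ab] half_pos] by blast
  obtain P where P: "\<And>z. cmod z = 1 \<Longrightarrow> a \<le> Re (poly P z) \<and> Re (poly P z) \<le> b"
    and P_close: "\<And>z. cmod z = 1 \<Longrightarrow> \<bar>H z - Re (poly P z)\<bar> < \<delta> / 2"
    using Stone_Weierstrass_circle_between[OF H ab half_pos] by blast
  have int: "integrable unit_lborel (\<lambda>t. \<phi> t - H (circ t))"
  proof (rule unit_lborel.integrable_const_bound[where B="b - a"])
    show "AE t in unit_lborel. norm (\<phi> t - H (circ t)) \<le> b - a"
      using bounds
    proof eventually_elim
      case (elim t)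
      then show ?case using H(2,3)[of "circ t"] by (simp add: abs_le_iff)
    qed
    show "(\<lambda>t. \<phi> t - H (circ t)) \<in> borel_measurable unit_lborel"
      by (intro borel_measurable_diff \<phi> measurable_unit_lborel measurable_compose_circ H)
  qed
  have "\<bar>\<phi> t - Re (poly P (circ t))\<bar> \<le> \<bar>\<phi> t - H (circ t)\<bar> + \<delta> / 2" for t
    using P_close[OF norm_circ, of t] by linarith
  then have "(\<integral>t. \<bar>\<phi> t - Re (poly P (circ t))\<bar> \<partial>unit_lborel)
      \<le> (\<integral>t. \<bar>\<phi> t - H (circ t)\<bar> + \<delta> / 2 \<partial>unit_lborel)"
    using int \<delta> by (intro integral_mono_AE') auto
  also have "\<dots> \<le> \<delta>"
    using int H_close unit_lborel.prob_space by simp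
  finally show ?thesis
    using P by (intro that) auto
qed

lemma Re_poly_l2_approx:
  fixes \<phi> :: "real \<Rightarrow> real"
  assumes \<phi> [measurable]: "\<phi> \<in> borel_measurable unit_lborel"
    and bounds: "AE t in unit_lborel. a \<le> \<phi> t \<and> \<phi> t \<le> b" and ab: "a < b" and e: "0 < e"
  obtains P where "l2_norm unit_lborel (\<lambda>t. of_real (\<phi> t) - of_real (Re (poly P (circ t)))) \<le> e"
proof -
  have "0 < e\<^sup>2 / (b - a)"
    using ab e by simp
  then obtain P where P: "\<And>z. cmod z = 1 \<Longrightarrow> a \<le> Re (poly P z)" "\<And>z. cmod z = 1 \<Longrightarrow> Re (poly P z) \<le> b"
    and P_close: "(\<integral>t. \<bar>\<phi> t - Re (poly P (circ t))\<bar> \<partial>unit_lborel) \<le> e\<^sup>2 / (b - a)"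
    using Re_poly_L1_approx[OF \<phi> bounds ab] by blast
  define d where "d t = \<phi> t - Re (poly P (circ t))" for t
  have [measurable]: "d \<in> borel_measurable unit_lborel"
    unfolding d_def using square_integrable_measurable[OF square_integrable_poly_circ[of P]] by measurable
  have d_bounded: "AE t in unit_lborel. \<bar>d t\<bar> \<le> b - a"
    using bounds
  proof eventually_elim
    case (elim t)
    then show ?case
      using P[of "circ t"] by (auto simp: d_def)
  qed
  have "(l2_norm unit_lborel (\<lambda>t. of_real (d t)))\<^sup>2 \<le> (\<integral>t. (b - a) * \<bar>d t\<bar> \<partial>unit_lborel)"
    unfolding l2_norm_power2
  proof (rule integral_mono_AE')
    show "integrable unit_lborel (\<lambda>t. (b - a) * \<bar>d t\<bar>)"
      using d_bounded by (auto intro!: unit_lborel.integrable_const_bound[where B="b - a"])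
    show "AE t in unit_lborel. (cmod (of_real (d t)))\<^sup>2 \<le> (b - a) * \<bar>d t\<bar>"
      using d_bounded
    proof eventually_elim
      case (elim t)
      then show ?case
        using mult_right_mono[of "\<bar>d t\<bar>" "b - a" "\<bar>d t\<bar>"] by (simp add: power2_eq_square)
    qed
  qed (use ab in auto)
  also have "\<dots> \<le> e\<^sup>2"
    using P_close ab by (simp add: d_def pos_le_divide_eq mult.commute)
  finally have "l2_norm unit_lborel (\<lambda>t. of_real (d t)) \<le> e"
    by (rule power2_le_imp_le) (use e in simp)
  then show ?thesis
    by (intro that[of P]) (simp add: d_def)
qed

lemma l2_inner_Re_poly_circ_eq_0:
  assumes f: "square_integrable unit_lborel f"
    and analytic: "\<And>n. fourier_coeff f n = 0"
    and coanalytic: "\<And>n. neg_fourier_coeff f n = 0"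
  shows "l2_inner unit_lborel f (\<lambda>t. of_real (Re (poly P (circ t)))) = 0"
proof -
  have P: "l2_inner unit_lborel f (\<lambda>t. poly P (circ t)) = 0"
    by (rule l2_inner_poly_circ_eq_0[OF f analytic])
  have "fourier_coeff (\<lambda>t. cnj (f t)) n = 0" for n
    using l2_inner_cnj_cnj[of unit_lborel f "\<lambda>t. cnj (circ t ^ n)"] coanalytic[of n] by simp
  then have "l2_inner unit_lborel (\<lambda>t. cnj (f t)) (\<lambda>t. poly P (circ t)) = 0"
    by (rule l2_inner_poly_circ_eq_0[OF square_integrable_cnj[OF f]])
  then have cnj_P: "l2_inner unit_lborel f (\<lambda>t. cnj (poly P (circ t))) = 0"
    using l2_inner_cnj_cnj[of unit_lborel f "\<lambda>t. cnj (poly P (circ t))"] by simp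
  have "complex_of_real (Re z) = 1/2 * z + 1/2 * cnj z" for z
    by (simp add: complex_eq_iff)
  then have "l2_inner unit_lborel f (\<lambda>t. of_real (Re (poly P (circ t))))
      = l2_inner unit_lborel f (\<lambda>t. 1/2 * poly P (circ t) + 1/2 * cnj (poly P (circ t)))"
    by (simp only:)
  also have "\<dots> = l2_inner unit_lborel f (\<lambda>t. 1/2 * poly P (circ t))
      + l2_inner unit_lborel f (\<lambda>t. 1/2 * cnj (poly P (circ t)))"
    by (intro l2_inner_add_right f square_integrable_cmult square_integrable_cnj square_integrable_poly_circ)
  finally show ?thesis
    by (simp only: l2_inner_cmult_right P cnj_P mult_zero_right add_0_left)
qed

lemma l2_inner_bounded_real_eq_0:
  fixes \<phi> :: "real \<Rightarrow> real"
  assumes f: "square_integrable unit_lborel f"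
    and analytic: "\<And>n. fourier_coeff f n = 0"
    and coanalytic: "\<And>n. neg_fourier_coeff f n = 0"
    and \<phi>: "\<phi> \<in> borel_measurable unit_lborel"
    and bounds: "AE t in unit_lborel. a \<le> \<phi> t \<and> \<phi> t \<le> b" and ab: "a < b"
  shows "l2_inner unit_lborel f (\<lambda>t. of_real (\<phi> t)) = 0"
proof (rule l2_inner_eq_0_closure[OF f])
  show "square_integrable unit_lborel (\<lambda>t. complex_of_real (\<phi> t))"
  proof (rule unit_lborel.square_integrable_bounded)
    show "AE t in unit_lborel. cmod (of_real (\<phi> t)) \<le> max \<bar>a\<bar> \<bar>b\<bar>"
      using bounds by eventually_elim auto
  qed (use \<phi> in measurable)
  fix e :: real assume e: "0 < e"
  obtain P where "l2_norm unit_lborel (\<lambda>t. of_real (\<phi> t) - of_real (Re (poly P (circ t)))) \<le> e"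
    using Re_poly_l2_approx[OF \<phi> bounds ab e] by blast
  moreover have "square_integrable unit_lborel (\<lambda>t. of_real (Re (poly P (circ t))))"
    by (rule square_integrable_circ) (intro continuous_intros)
  ultimately show "\<exists>b'. square_integrable unit_lborel b' \<and> l2_inner unit_lborel f b' = 0
      \<and> l2_norm unit_lborel (\<lambda>t. of_real (\<phi> t) - b' t) \<le> e"
    using l2_inner_Re_poly_circ_eq_0[OF f analytic coanalytic] by blast
qed

lemma fourier_uniqueness:
  assumes f: "square_integrable unit_lborel f"
    and "\<And>n. fourier_coeff f n = 0"
    and "\<And>n. neg_fourier_coeff f n = 0"
  shows "AE t in unit_lborel. f t = 0"
proof (rule unit_lborel.density_zero)
  show "integrable unit_lborel f"
    by (rule unit_lborel.integrable_of_square_integrable[OF f])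
  fix A assume "A \<in> sets unit_lborel"
  then have "l2_inner unit_lborel f (\<lambda>t. of_real (indicator A t)) = 0"
    by (intro l2_inner_bounded_real_eq_0[where a=0 and b=1] assms) auto
  then show "set_lebesgue_integral unit_lborel A f = 0"
    by (simp add: l2_inner_def set_lebesgue_integral_def scaleR_conv_of_real mult.commute)
qed

section \<open>The closure of the analytic polynomials\<close>

definition poly_limit :: "(real \<Rightarrow> complex) \<Rightarrow> bool" where
  "poly_limit b \<longleftrightarrow> square_integrable unit_lborel b \<and>
     (\<forall>e>0. \<exists>P. l2_norm unit_lborel (\<lambda>t. b t - poly P (circ t)) < e)"

lemma poly_limit_square_integrable: "poly_limit b \<Longrightarrow> square_integrable unit_lborel b"
  by (simp add: poly_limit_def)

lemma poly_limit_closed: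
  assumes b: "square_integrable unit_lborel b"
    and lim: "\<And>e. 0 < e \<Longrightarrow> \<exists>b'. poly_limit b' \<and> l2_norm unit_lborel (\<lambda>t. b t - b' t) < e"
  shows "poly_limit b"
  unfolding poly_limit_def
proof (intro conjI b allI impI)
  fix e :: real assume e: "0 < e"
  obtain b' where b': "poly_limit b'" and close: "l2_norm unit_lborel (\<lambda>t. b t - b' t) < e / 2"
    using lim[of "e / 2"] e by auto
  obtain P where P: "l2_norm unit_lborel (\<lambda>t. b' t - poly P (circ t)) < e / 2"
    using b' e unfolding poly_limit_def by (meson half_gt_zero)
  have "l2_norm unit_lborel (\<lambda>t. b t - poly P (circ t)) < e"
    using l2_norm_triangle_diff[OF b poly_limit_square_integrable[OF b'] square_integrable_poly_circ[of P]]
      close P by simp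
  then show "\<exists>P. l2_norm unit_lborel (\<lambda>t. b t - poly P (circ t)) < e" ..
qed

lemma poly_limit_orthogonal:
  assumes b: "poly_limit b" and q: "square_integrable unit_lborel q"
    and orth: "\<And>n. fourier_coeff q n = 0"
  shows "l2_inner unit_lborel q b = 0"
proof (rule l2_inner_eq_0_closure[OF q poly_limit_square_integrable[OF b]])
  fix e :: real assume "0 < e"
  then obtain P where "l2_norm unit_lborel (\<lambda>t. b t - poly P (circ t)) < e"
    using b unfolding poly_limit_def by blast
  then show "\<exists>b'. square_integrable unit_lborel b' \<and> l2_inner unit_lborel q b' = 0
      \<and> l2_norm unit_lborel (\<lambda>t. b t - b' t) \<le> e"
    using l2_inner_poly_circ_eq_0[OF q orth]
    by (intro exI[of _ "\<lambda>t. poly P (circ t)"]) simp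
qed

lemma neg_fourier_coeff_poly_limit:
  assumes b: "poly_limit b"
  shows "neg_fourier_coeff b (Suc n) = 0"
proof -
  have "l2_inner unit_lborel (\<lambda>t. cnj (circ t ^ Suc n)) b = 0"
  proof (rule poly_limit_orthogonal[OF b])
    show "square_integrable unit_lborel (\<lambda>t. cnj (circ t ^ Suc n))"
      by (rule square_integrable_cnj[OF square_integrable_circ_power])
    show "fourier_coeff (\<lambda>t. cnj (circ t ^ Suc n)) k = 0" for k
      using arg_cong[OF neg_fourier_coeff_poly[of "monom 1 k" n], of cnj]
      by (simp add: cnj_l2_inner poly_monom del: power_Suc)
  qed
  from arg_cong[OF this, of cnj] show ?thesis
    by (simp add: cnj_l2_inner del: power_Suc)
qed

lemma holomorphic_uniform_poly_approx:
  assumes f: "f holomorphic_on ball 0 R" and R: "1 < R" and e: "0 < e"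
  obtains P where "\<And>z. cmod z \<le> 1 \<Longrightarrow> cmod (f z - poly P z) < e"
proof -
  define a where "a n = (deriv ^^ n) f 0 / fact n" for n
  have sums: "(\<lambda>n. a n * z ^ n) sums f z" if "cmod z < R" for z
    using holomorphic_power_series[OF f, of z] that by (simp add: a_def)
  define \<rho> where "\<rho> = (1 + R) / 2"
  have \<rho>: "1 < \<rho>" "\<rho> < R" using R by (auto simp: \<rho>_def)
  have "summable (\<lambda>n. a n * of_real \<rho> ^ n)"
    using sums[of "of_real \<rho>"] \<rho> by (auto simp: summable_def)
  then have "ereal (norm (complex_of_real \<rho>)) \<le> conv_radius a"
    by (rule conv_radius_geI)
  then have "uniform_limit (cball 0 1) (\<lambda>N z. \<Sum>n<N. a n * (z - 0) ^ n) (\<lambda>z. \<Sum>n. a n * (z - 0) ^ n) sequentially"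
    using \<rho> by (intro powser_uniform_limit) (auto intro: less_le_trans[rotated])
  from uniform_limitD[OF this e] obtain N
    where N: "\<forall>z\<in>cball 0 1. dist (\<Sum>n<N. a n * z ^ n) (\<Sum>n. a n * z ^ n) < e"
    by (auto simp: eventually_sequentially)
  have "cmod (f z - poly (\<Sum>n<N. monom (a n) n) z) < e" if "cmod z \<le> 1" for z
    using bspec[OF N, of z] sums_unique[OF sums[of z]] R that
    by (simp add: poly_sum poly_monom dist_norm norm_minus_commute)
  then show ?thesis by (rule that)
qed

lemma poly_limit_holomorphic:
  assumes f: "f holomorphic_on ball 0 R" and R: "1 < R"
  shows "poly_limit (\<lambda>t. f (circ t))"
  unfolding poly_limit_def
proof (intro conjI allI impI)
  have "continuous_on (sphere 0 1) f"
    using R by (intro continuous_on_subset[OF holomorphic_on_imp_continuous_on[OF f]]) auto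
  then show sf: "square_integrable unit_lborel (\<lambda>t. f (circ t))"
    by (rule square_integrable_circ)
  fix e :: real assume e: "0 < e"
  then obtain P where P: "\<And>z. cmod z \<le> 1 \<Longrightarrow> cmod (f z - poly P z) < e / 2"
    using holomorphic_uniform_poly_approx[OF f R, of "e / 2"] by auto
  have "cmod (f (circ t) - poly P (circ t)) \<le> e / 2" for t
    using P[of "circ t"] by simp
  then have "l2_norm unit_lborel (\<lambda>t. f (circ t) - poly P (circ t)) \<le> e / 2"
    using e sf
    by (intro unit_lborel.l2_norm_bounded square_integrable_measurable square_integrable_diff) auto
  then show "\<exists>P. l2_norm unit_lborel (\<lambda>t. f (circ t) - poly P (circ t)) < e"
    using e by (intro exI[of _ P]) simp
qed

section \<open>The Hardy space and the Riesz projection\<close>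

lemma L2T_iff:
  "L2T h \<longleftrightarrow> (\<lambda>t. h (circ t)) \<in> borel_measurable lborel \<and> square_integrable unit_lborel (\<lambda>t. h (circ t))"
  by (auto simp: L2T_def square_integrable_def set_integrable_unit_lborel intro: measurable_restrict_space1)

lemma L2norm_eq_l2_norm: "L2norm h = l2_norm unit_lborel (\<lambda>t. h (circ t))"
  by (simp add: L2norm_def l2_norm_def set_integral_unit_lborel)

lemma circ_power_eq_cis: "circ t ^ n = cis (2 * pi * real n * t)"
  using Complex.DeMoivre[of "2 * pi * t" n] by (simp add: circ_def mult_ac)

lemma fcoeff_of_nat: "fcoeff h (int n) = fourier_coeff (\<lambda>t. h (circ t)) n"
  unfolding fcoeff_def set_integral_unit_lborel l2_inner_def circ_power_eq_cis cis_cnj by simp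

lemma fcoeff_minus_of_nat:
  "fcoeff h (- int n) = neg_fourier_coeff (\<lambda>t. h (circ t)) n"
  unfolding fcoeff_def set_integral_unit_lborel l2_inner_def circ_power_eq_cis complex_cnj_cnj by simp

lemma H2_iff:
  "H2 h \<longleftrightarrow> L2T h \<and> (\<forall>n. neg_fourier_coeff (\<lambda>t. h (circ t)) (Suc n) = 0)"
proof -
  have "(\<forall>n<0. fcoeff h n = 0) \<longleftrightarrow> (\<forall>n. fcoeff h (- int (Suc n)) = 0)"
    by (metis neg_int_cases negative_zless_0 gr0_conv_Suc)
  then show ?thesis
    unfolding H2_def fcoeff_minus_of_nat by blast
qed

lemma H2_square_integrable: "H2 h \<Longrightarrow> square_integrable unit_lborel (\<lambda>t. h (circ t))"
  by (simp add: H2_def L2T_iff)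

lemma exists_poly_limit_fourier_coeff:
  assumes q: "square_integrable unit_lborel q"
  obtains p where "(\<lambda>t. p (circ t)) \<in> borel_measurable borel" "poly_limit (\<lambda>t. p (circ t))"
    "\<And>n. fourier_coeff (\<lambda>t. p (circ t)) n = fourier_coeff q n"
proof -
  define c where "c n = fourier_coeff q n" for n
  have "summable (\<lambda>n. (cmod (c n))\<^sup>2)"
    unfolding c_def using Bessel_inequality[OF orthonormal_circ_power q]
    by (intro summableI_nonneg_bounded) auto
  from unit_lborel.Riesz_Fischer[OF orthonormal_circ_power this] obtain r
    where "square_integrable unit_lborel (\<lambda>t. lim (\<lambda>k. \<Sum>n<r k. c n * circ t ^ n))"
      and "(\<lambda>m. l2_norm unit_lborel (\<lambda>t. (\<Sum>n<m. c n * circ t ^ n) - lim (\<lambda>k. \<Sum>n<r k. c n * circ t ^ n))) \<longlonglongrightarrow> 0"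
      and "\<And>n. fourier_coeff (\<lambda>t. lim (\<lambda>k. \<Sum>n<r k. c n * circ t ^ n)) n = c n"
    by blast
  moreover define p where "p z = lim (\<lambda>k. \<Sum>n<r k. c n * z ^ n)" for z
  ultimately have sp: "square_integrable unit_lborel (\<lambda>t. p (circ t))"
    and lim: "(\<lambda>m. l2_norm unit_lborel (\<lambda>t. (\<Sum>n<m. c n * circ t ^ n) - p (circ t))) \<longlonglongrightarrow> 0"
    and coeff: "\<And>n. fourier_coeff (\<lambda>t. p (circ t)) n = c n"
    by simp_all
  have "(\<lambda>t. \<Sum>n<m. c n * circ t ^ n) \<in> borel_measurable borel" for m
    by (rule measurable_compose_circ[where F="\<lambda>z. \<Sum>n<m. c n * z ^ n"]) (intro continuous_intros)
  then have "(\<lambda>t. p (circ t)) \<in> borel_measurable borel"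
    unfolding p_def by measurable
  moreover have "poly_limit (\<lambda>t. p (circ t))"
    unfolding poly_limit_def
  proof (intro conjI sp allI impI)
    fix e :: real assume "0 < e"
    then obtain m where "l2_norm unit_lborel (\<lambda>t. (\<Sum>n<m. c n * circ t ^ n) - p (circ t)) < e"
      using order_tendstoD(2)[OF lim] by (auto simp: eventually_sequentially)
    then show "\<exists>P. l2_norm unit_lborel (\<lambda>t. p (circ t) - poly P (circ t)) < e"
      by (intro exI[of _ "\<Sum>n<m. monom (c n) n"])
         (simp add: poly_sum poly_monom l2_norm_minus_commute[of _ "\<lambda>t. p (circ t)"])
  qed
  ultimately show ?thesis
    using coeff unfolding c_def by (rule that)
qed

lemma H2_iff_poly_limit: "H2 h \<longleftrightarrow> L2T h \<and> poly_limit (\<lambda>t. h (circ t))"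
proof (intro iffI conjI)
  assume h: "H2 h"
  note sh = H2_square_integrable[OF h]
  obtain p where p: "poly_limit (\<lambda>t. p (circ t))"
    and coeff: "\<And>n. fourier_coeff (\<lambda>t. p (circ t)) n = fourier_coeff (\<lambda>t. h (circ t)) n"
    using exists_poly_limit_fourier_coeff[OF sh] by blast
  note sp = poly_limit_square_integrable[OF p]
  have analytic: "fourier_coeff (\<lambda>t. h (circ t) - p (circ t)) n = 0" for n
    by (simp add: l2_inner_diff_left sh sp coeff)
  have "neg_fourier_coeff (\<lambda>t. h (circ t) - p (circ t)) n = 0" for n
  proof (cases n)
    case 0
    then show ?thesis using analytic[of 0] by simp
  next
    case (Suc m)
    then show ?thesis
      using neg_fourier_coeff_poly_limit[OF p, of m] h
      by (simp only: l2_inner_diff_left[OF sh sp square_integrable_cnj[OF square_integrable_circ_power]] H2_iff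
          diff_self)
  qed
  then have "AE t in unit_lborel. h (circ t) - p (circ t) = 0"
    by (intro fourier_uniqueness square_integrable_diff sh sp analytic)
  then have "l2_norm unit_lborel (\<lambda>t. h (circ t) - p (circ t)) = 0"
    by (rule l2_norm_eq_0_AE)
  with p show "poly_limit (\<lambda>t. h (circ t))"
    by (intro poly_limit_closed[OF sh]) auto
next
  assume "L2T h \<and> poly_limit (\<lambda>t. h (circ t))"
  then show "H2 h"
    unfolding H2_iff using neg_fourier_coeff_poly_limit by blast
qed (simp add: H2_def)

lemma Riesz_projection_exists:
  assumes "L2T q"
  shows "\<exists>p. H2 p \<and> (\<forall>n\<ge>0. fcoeff p n = fcoeff q n)"
proof -
  obtain p where "(\<lambda>t. p (circ t)) \<in> borel_measurable borel" "poly_limit (\<lambda>t. p (circ t))"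
    and coeff: "\<And>n. fourier_coeff (\<lambda>t. p (circ t)) n = fourier_coeff (\<lambda>t. q (circ t)) n"
    using exists_poly_limit_fourier_coeff[of "\<lambda>t. q (circ t)"] assms unfolding L2T_iff by blast
  then have "H2 p"
    by (simp add: H2_iff_poly_limit L2T_iff poly_limit_square_integrable)
  moreover have "fcoeff p n = fcoeff q n" if "0 \<le> n" for n
    using that coeff[of "nat n"] fcoeff_of_nat[of _ "nat n"] by simp
  ultimately show ?thesis by blast
qed

lemma
  assumes "L2T q"
  shows H2_Proj: "H2 (Proj q)" and fcoeff_Proj: "0 \<le> n \<Longrightarrow> fcoeff (Proj q) n = fcoeff q n"
  using someI_ex[OF Riesz_projection_exists[OF assms]] by (auto simp: Proj_def)

lemma l2_inner_Proj:
  assumes q: "L2T q" and b: "poly_limit b"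
  shows "l2_inner unit_lborel (\<lambda>t. Proj q (circ t)) b = l2_inner unit_lborel (\<lambda>t. q (circ t)) b"
proof -
  have sq: "square_integrable unit_lborel (\<lambda>t. q (circ t))"
    and sp: "square_integrable unit_lborel (\<lambda>t. Proj q (circ t))"
    using q H2_Proj[OF q] by (simp_all add: H2_def L2T_iff)
  have "fourier_coeff (\<lambda>t. Proj q (circ t) - q (circ t)) n = 0" for n
    using fcoeff_Proj[OF q, of "int n"] by (simp add: l2_inner_diff_left sp sq fcoeff_of_nat)
  then have "l2_inner unit_lborel (\<lambda>t. Proj q (circ t) - q (circ t)) b = 0"
    by (intro poly_limit_orthogonal[OF b] square_integrable_diff sp sq)
  then show ?thesis
    by (simp add: l2_inner_diff_left sp sq poly_limit_square_integrable[OF b])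
qed

section \<open>Dilations\<close>

definition disc_series :: "(real \<Rightarrow> complex) \<Rightarrow> complex \<Rightarrow> complex" where
  "disc_series b z = (\<Sum>n. fourier_coeff b n * z ^ n)"

lemma disc_ext_eq_disc_series: "disc_ext h = disc_series (\<lambda>t. h (circ t))"
  by (simp add: fun_eq_iff disc_ext_def disc_series_def fcoeff_of_nat)

lemma disc_series_sums:
  assumes b: "square_integrable unit_lborel b" and z: "cmod z < 1"
  shows "(\<lambda>n. fourier_coeff b n * z ^ n) sums disc_series b z"
  unfolding disc_series_def
proof (rule summable_sums[OF summable_comparison_test[OF exI[of _ 0]]])
  show "summable (\<lambda>n. l2_norm unit_lborel b * cmod z ^ n)"
    using z by (intro summable_mult summable_geometric) simp
  show "\<forall>n\<ge>0. norm (fourier_coeff b n * z ^ n) \<le> l2_norm unit_lborel b * cmod z ^ n"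
    using norm_l2_inner_orthonormal_le[OF orthonormal_circ_power b]
    by (auto simp: norm_mult norm_power intro: mult_right_mono)
qed

lemma holomorphic_disc_series:
  "square_integrable unit_lborel b \<Longrightarrow> disc_series b holomorphic_on ball 0 1"
  using disc_series_sums[of b] by (intro power_series_holomorphic) auto

lemma disc_series_poly: "disc_series (\<lambda>t. poly P (circ t)) z = poly P z"
  unfolding disc_series_def fourier_coeff_poly unfolding poly_altdef
  by (rule suminf_finite) (auto simp: coeff_eq_0)

lemma disc_series_diff:
  assumes "square_integrable unit_lborel a" "square_integrable unit_lborel b" "cmod z < 1"
  shows "disc_series (\<lambda>t. a t - b t) z = disc_series a z - disc_series b z"
proof -
  have "(\<lambda>n. fourier_coeff (\<lambda>t. a t - b t) n * z ^ n) sums (disc_series a z - disc_series b z)"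
    using sums_diff[OF disc_series_sums disc_series_sums] assms
    by (simp add: l2_inner_diff_left left_diff_distrib)
  then show ?thesis
    unfolding disc_series_def by (rule sums_unique[symmetric])
qed

lemma holomorphic_disc_series_dilation:
  assumes b: "square_integrable unit_lborel b" and r: "0 < r"
  shows "(\<lambda>z. disc_series b (of_real r * z)) holomorphic_on ball 0 (1 / r)"
proof -
  have "(disc_series b \<circ> (\<lambda>z. of_real r * z)) holomorphic_on ball 0 (1 / r)"
    using r by (intro holomorphic_on_compose_gen[OF _ holomorphic_disc_series[OF b]] holomorphic_intros)
      (auto simp: norm_mult field_simps)
  then show ?thesis by (simp add: o_def)
qed

lemma square_integrable_disc_series_dilation:
  assumes b: "square_integrable unit_lborel b" and r: "0 < r" "r < 1"
  shows "square_integrable unit_lborel (\<lambda>t. disc_series b (of_real r * circ t))"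
  by (rule square_integrable_circ, rule continuous_on_subset)
     (use r in \<open>auto intro!: holomorphic_on_imp_continuous_on holomorphic_disc_series_dilation b\<close>)

lemma l2_norm_disc_series_dilation_le:
  assumes b: "square_integrable unit_lborel b" and r: "0 < r" "r < 1"
  shows "l2_norm unit_lborel (\<lambda>t. disc_series b (of_real r * circ t)) \<le> l2_norm unit_lborel b"
proof (rule l2_norm_Fatou)
  define c where "c n = fourier_coeff b n" for n
  let ?S = "\<lambda>m t. \<Sum>n<m. (c n * of_real r ^ n) * circ t ^ n"
  show "square_integrable unit_lborel (?S m)" for m
    by (rule orthonormal_family_square_integrable_sum[OF orthonormal_circ_power])
  show "l2_norm unit_lborel (?S m) \<le> l2_norm unit_lborel b" for m
  proof (rule power2_le_imp_le)
    have "(l2_norm unit_lborel (?S m))\<^sup>2 = (\<Sum>n<m. (cmod (c n * of_real r ^ n))\<^sup>2)"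
      by (rule l2_norm_orthonormal_sum[OF orthonormal_circ_power]) simp
    also have "\<dots> \<le> (\<Sum>n<m. (cmod (c n))\<^sup>2)"
      using r by (intro sum_mono power_mono) (auto simp: norm_mult norm_power mult_left_le power_le_one)
    also have "\<dots> \<le> (l2_norm unit_lborel b)\<^sup>2"
      unfolding c_def by (rule Bessel_inequality[OF orthonormal_circ_power b]) simp
    finally show "(l2_norm unit_lborel (?S m))\<^sup>2 \<le> (l2_norm unit_lborel b)\<^sup>2" .
  qed simp
  have "(\<lambda>m. ?S m t) \<longlonglongrightarrow> disc_series b (of_real r * circ t)" for t
    using disc_series_sums[OF b, of "of_real r * circ t"] r
    by (simp add: sums_def c_def norm_mult power_mult_distrib mult.assoc)
  then show "AE t in unit_lborel. (\<lambda>m. ?S m t) \<longlonglongrightarrow> disc_series b (of_real r * circ t)"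
    by simp
qed (rule square_integrable_measurable[OF square_integrable_disc_series_dilation[OF b r]])

lemma l2_norm_disc_series_poly_dilation_diff_le:
  assumes b: "square_integrable unit_lborel b" and r: "0 < r" "r < 1"
  shows "l2_norm unit_lborel (\<lambda>t. disc_series b (of_real r * circ t) - poly P (of_real r * circ t))
    \<le> l2_norm unit_lborel (\<lambda>t. b t - poly P (circ t))"
proof -
  have "disc_series (\<lambda>t. b t - poly P (circ t)) (of_real r * circ t)
      = disc_series b (of_real r * circ t) - poly P (of_real r * circ t)" for t
    using b r by (simp add: disc_series_diff disc_series_poly norm_mult)
  then show ?thesis
    using l2_norm_disc_series_dilation_le[OF square_integrable_diff[OF b square_integrable_poly_circ] r, of P]
    by simp
qed

lemma poly_dilation_uniformly_close:
  assumes e: "0 < e"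
  shows "\<forall>\<^sub>F r in at_left 1. \<forall>z. cmod z = 1 \<longrightarrow> cmod (poly P z - poly P (of_real r * z)) \<le> e"
proof -
  have "uniformly_continuous_on (cball 0 1) (poly P)"
    by (intro compact_uniformly_continuous continuous_intros) simp
  then obtain d where d: "0 < d"
    and close: "\<And>z w. z \<in> cball 0 1 \<Longrightarrow> w \<in> cball 0 1 \<Longrightarrow> dist w z < d \<Longrightarrow> dist (poly P w) (poly P z) < e"
    using e unfolding uniformly_continuous_on_def by metis
  have "\<forall>\<^sub>F r in at_left 1. max 0 (1 - d) < r \<and> r < 1"
    using d eventually_at_left_real[of "max 0 (1 - d)" 1] by (simp add: greaterThanLessThan_iff)
  then show ?thesis
  proof (eventually_elim, intro allI impI)
    fix r :: real and z :: complex assume r: "max 0 (1 - d) < r \<and> r < 1" and z: "cmod z = 1"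
    have "z - of_real r * z = of_real (1 - r) * z"
      by (simp add: algebra_simps)
    then have "dist z (of_real r * z) = 1 - r"
      using r z by (simp add: dist_norm norm_mult del: of_real_diff)
    then have "dist (poly P z) (poly P (of_real r * z)) < e"
      using r z by (intro close) (auto simp: norm_mult)
    then show "cmod (poly P z - poly P (of_real r * z)) \<le> e"
      by (simp add: dist_norm)
  qed
qed

lemma disc_series_dilation_tendsto:
  assumes b: "poly_limit b"
  shows "((\<lambda>r. l2_norm unit_lborel (\<lambda>t. b t - disc_series b (of_real r * circ t))) \<longlongrightarrow> 0) (at_left 1)"
proof (rule tendstoI)
  fix e :: real assume e: "0 < e"
  note sb = poly_limit_square_integrable[OF b]
  obtain P where P: "l2_norm unit_lborel (\<lambda>t. b t - poly P (circ t)) < e / 3"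
    using b e unfolding poly_limit_def by (meson divide_pos_pos zero_less_numeral)
  have "\<forall>\<^sub>F r in at_left (1::real). 0 < r \<and> r < 1"
    using eventually_at_left_real[of 0 1] by simp
  moreover have "\<forall>\<^sub>F r in at_left 1. \<forall>z. cmod z = 1 \<longrightarrow> cmod (poly P z - poly P (of_real r * z)) \<le> e / 3"
    using e by (intro poly_dilation_uniformly_close) simp
  ultimately show "\<forall>\<^sub>F r in at_left 1.
      dist (l2_norm unit_lborel (\<lambda>t. b t - disc_series b (of_real r * circ t))) 0 < e"
  proof eventually_elim
    case (elim r)
    let ?P = "\<lambda>t. poly P (circ t)" and ?P\<^sub>r = "\<lambda>t. poly P (of_real r * circ t)"
      and ?b\<^sub>r = "\<lambda>t. disc_series b (of_real r * circ t)"
    have sbr: "square_integrable unit_lborel ?b\<^sub>r"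
      using elim by (intro square_integrable_disc_series_dilation sb) auto
    have sPr: "square_integrable unit_lborel ?P\<^sub>r"
      by (rule square_integrable_circ) (intro continuous_intros)
    have "l2_norm unit_lborel (\<lambda>t. b t - ?b\<^sub>r t)
        \<le> l2_norm unit_lborel (\<lambda>t. b t - ?P t) + (l2_norm unit_lborel (\<lambda>t. ?P t - ?P\<^sub>r t)
          + l2_norm unit_lborel (\<lambda>t. ?P\<^sub>r t - ?b\<^sub>r t))"
      using l2_norm_triangle_diff[OF sb square_integrable_poly_circ[of P] sbr]
        l2_norm_triangle_diff[OF square_integrable_poly_circ[of P] sPr sbr] by linarith
    moreover have "l2_norm unit_lborel (\<lambda>t. ?P t - ?P\<^sub>r t) \<le> e / 3"
      using elim e sPr
      by (intro unit_lborel.l2_norm_bounded square_integrable_measurable square_integrable_diff) auto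
    moreover have "l2_norm unit_lborel (\<lambda>t. ?P\<^sub>r t - ?b\<^sub>r t) \<le> l2_norm unit_lborel (\<lambda>t. b t - ?P t)"
      using elim by (subst l2_norm_minus_commute) (intro l2_norm_disc_series_poly_dilation_diff_le sb; simp)
    ultimately show ?case
      using P by simp
  qed
qed

lemma norm_inverse_power_diff_le:
  fixes x y :: complex
  assumes "1 \<le> cmod x" "1 \<le> cmod y"
  shows "cmod (inverse x ^ k - inverse y ^ k) \<le> real k * cmod (x - y)"
proof -
  have nz: "x \<noteq> 0" "y \<noteq> 0" using assms by auto
  have "cmod (inverse x ^ k - inverse y ^ k) \<le> real k * cmod (inverse x - inverse y)"
    by (rule norm_power_diff) (use assms in \<open>auto simp: norm_inverse inverse_le_1_iff\<close>)
  also have "inverse x - inverse y = (y - x) / (x * y)"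
    using nz by (simp add: field_simps)
  also have "cmod \<dots> = cmod (x - y) / (cmod x * cmod y)"
    by (simp add: norm_divide norm_mult norm_minus_commute)
  also have "\<dots> \<le> cmod (x - y)"
    using assms mult_mono[of 1 "cmod x" 1 "cmod y"] nz
    by (simp add: divide_le_eq mult_le_cancel_left1)
  finally show ?thesis by (simp add: mult_left_mono)
qed

lemma norm_inverse_power_le_1: "1 \<le> cmod x \<Longrightarrow> cmod (inverse x ^ k) \<le> 1"
  by (simp add: norm_power norm_inverse inverse_le_1_iff power_le_one)

lemma l2_norm_inverse_power_mult_diff_le:
  assumes a [measurable]: "square_integrable M a" "AE x in M. 1 \<le> cmod (a x)"
    and b [measurable]: "square_integrable M b" "AE x in M. 1 \<le> cmod (b x)"
    and h [measurable]: "h \<in> borel_measurable M" and bounds: "AE x in M. cmod (h x) \<le> B" and B: "0 \<le> B"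
  shows "l2_norm M (\<lambda>x. inverse (a x) ^ k * h x - inverse (b x) ^ k * h x)
    \<le> real k * B * l2_norm M (\<lambda>x. a x - b x)"
proof (rule l2_norm_AE_le)
  show "AE x in M. cmod (inverse (a x) ^ k * h x - inverse (b x) ^ k * h x) \<le> real k * B * cmod (a x - b x)"
    using a(2) b(2) bounds
  proof eventually_elim
    case (elim x)
    have "cmod (inverse (a x) ^ k * h x - inverse (b x) ^ k * h x)
        = cmod (inverse (a x) ^ k - inverse (b x) ^ k) * cmod (h x)"
      by (simp add: left_diff_distrib flip: norm_mult)
    also have "\<dots> \<le> (real k * cmod (a x - b x)) * B"
      using elim by (intro mult_mono norm_inverse_power_diff_le) auto
    finally show ?case by (simp add: mult_ac)
  qed
qed (use B in \<open>auto intro: square_integrable_diff a b\<close>)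

lemma poly_limit_inverse_power_dilation_mult:
  assumes b: "square_integrable unit_lborel b"
    and ext_ge: "\<And>z. cmod z < 1 \<Longrightarrow> 1 \<le> cmod (disc_series b z)"
    and F: "F holomorphic_on UNIV" and r: "0 < r" "r < 1"
  shows "poly_limit (\<lambda>t. inverse (disc_series b (of_real r * circ t)) ^ k * F (circ t))"
proof (rule poly_limit_holomorphic)
  have "disc_series b (of_real r * z) \<noteq> 0" if "cmod z < 1 / r" for z
    using ext_ge[of "of_real r * z"] r that by (fastforce simp: norm_mult field_simps)
  then show "(\<lambda>z. inverse (disc_series b (of_real r * z)) ^ k * F z) holomorphic_on ball 0 (1 / r)"
    by (intro holomorphic_intros holomorphic_disc_series_dilation b r holomorphic_on_subset[OF F]) auto
qed (use r in simp)

lemma poly_limit_inverse_power_mult: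
  assumes b: "poly_limit b" and b_ge: "AE t in unit_lborel. 1 \<le> cmod (b t)"
    and ext_ge: "\<And>z. cmod z < 1 \<Longrightarrow> 1 \<le> cmod (disc_series b z)"
    and F: "F holomorphic_on UNIV"
  shows "poly_limit (\<lambda>t. inverse (b t) ^ k * F (circ t))"
proof (rule poly_limit_closed)
  have contF: "continuous_on (sphere 0 1) F"
    using holomorphic_on_imp_continuous_on[OF F] by (rule continuous_on_subset) simp
  note sb = poly_limit_square_integrable[OF b] and sF = square_integrable_circ[OF contF]
  note [measurable] = sb
  show "square_integrable unit_lborel (\<lambda>t. inverse (b t) ^ k * F (circ t))"
    by (rule square_integrable_bounded_mult[OF sF, where C=1], measurable)
       (use b_ge in eventually_elim, rule norm_inverse_power_le_1)
  obtain B where B: "0 < B" "\<And>z. cmod z = 1 \<Longrightarrow> cmod (F z) \<le> B"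
    using continuous_on_circle_bounded[OF contF] by blast
  fix e :: real assume e: "0 < e"
  have kB: "0 < real k * B + 1" using B by (simp add: add_nonneg_pos)
  then have "0 < e / (real k * B + 1)" using e by simp
  from order_tendstoD(2)[OF disc_series_dilation_tendsto[OF b] this]
  have "\<forall>\<^sub>F r in at_left 1. r \<in> {0<..<1} \<and>
      l2_norm unit_lborel (\<lambda>t. b t - disc_series b (of_real r * circ t)) < e / (real k * B + 1)"
    by (intro eventually_conj eventually_at_left_real) simp_all
  then obtain r :: real where r: "0 < r" "r < 1"
    and close: "l2_norm unit_lborel (\<lambda>t. b t - disc_series b (of_real r * circ t)) < e / (real k * B + 1)"
    using eventually_happens'[of "at_left (1::real)"] by (auto simp: trivial_limit_at_left_real)
  define G where "G t = disc_series b (of_real r * circ t)" for t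
  have "l2_norm unit_lborel (\<lambda>t. inverse (b t) ^ k * F (circ t) - inverse (G t) ^ k * F (circ t))
      \<le> real k * B * l2_norm unit_lborel (\<lambda>t. b t - G t)"
  proof (rule l2_norm_inverse_power_mult_diff_le[OF sb b_ge])
    show "square_integrable unit_lborel G"
      unfolding G_def[abs_def] by (rule square_integrable_disc_series_dilation[OF sb r])
    show "AE t in unit_lborel. 1 \<le> cmod (G t)" "AE t in unit_lborel. cmod (F (circ t)) \<le> B"
      using ext_ge[of "of_real r * circ _"] r B by (auto simp: G_def norm_mult)
  qed (use sF B in \<open>auto intro: square_integrable_measurable\<close>)
  also have "\<dots> \<le> (real k * B + 1) * l2_norm unit_lborel (\<lambda>t. b t - G t)"
    by (intro mult_right_mono) auto
  also have "\<dots> < e"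
    using close kB by (simp add: G_def pos_less_divide_eq mult.commute)
  finally show "\<exists>b'. poly_limit b' \<and> l2_norm unit_lborel (\<lambda>t. inverse (b t) ^ k * F (circ t) - b' t) < e"
    using poly_limit_inverse_power_dilation_mult[OF sb ext_ge F r] unfolding G_def by blast
qed

section \<open>Test functions\<close>

lemma integral_min_0_of_nat_add_tendsto_0:
  fixes w :: "'a \<Rightarrow> real"
  assumes [measurable]: "integrable M w"
  shows "(\<lambda>n. \<integral>x. min 0 (real n + w x) \<partial>M) \<longlonglongrightarrow> 0"
proof -
  have "(\<lambda>n. \<integral>x. min 0 (real n + w x) \<partial>M) \<longlonglongrightarrow> (\<integral>x. 0 \<partial>M)"
  proof (rule integral_dominated_convergence[where w="\<lambda>x. \<bar>w x\<bar>"])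
    have "(\<lambda>n. min 0 (real n + y)) \<longlonglongrightarrow> 0" for y
    proof (rule tendsto_eventually)
      have "\<forall>\<^sub>F n in sequentially. - y \<le> real n"
        using filterlim_real_sequentially by (simp add: filterlim_at_top)
      then show "\<forall>\<^sub>F n in sequentially. min 0 (real n + y) = 0"
        by eventually_elim simp
    qed
    then show "AE x in M. (\<lambda>n. min 0 (real n + w x)) \<longlonglongrightarrow> 0" by simp
    show "AE x in M. norm (min 0 (real n + w x)) \<le> \<bar>w x\<bar>" for n by auto
  qed (use assms in auto)
  then show ?thesis by simp
qed

lemma integrable_Re_poly_circ: "integrable unit_lborel (\<lambda>t. Re (poly P (circ t)))"
  by (intro integrable_Re unit_lborel.integrable_of_square_integrable) simp

lemma integral_Re_poly_circ: "(\<integral>t. Re (poly P (circ t)) \<partial>unit_lborel) = Re (poly P 0)"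
proof -
  have "(\<integral>t. poly P (circ t) \<partial>unit_lborel) = poly P 0"
    by (rule integral_circ_mean_value) (intro continuous_intros holomorphic_intros)+
  then show ?thesis
    by (simp add: unit_lborel.integrable_of_square_integrable)
qed

lemma nonpos_Re_poly_L1_approx:
  fixes \<phi> :: "real \<Rightarrow> real"
  assumes int [measurable]: "integrable unit_lborel \<phi>" and neg: "\<And>t. \<phi> t \<le> 0" and \<delta>: "0 < \<delta>"
  obtains P where "\<And>z. cmod z = 1 \<Longrightarrow> Re (poly P z) \<le> 0" "Im (poly P 0) = 0"
    "(\<integral>t. \<bar>\<phi> t - Re (poly P (circ t))\<bar> \<partial>unit_lborel) \<le> \<delta>"
proof -
  have "\<forall>\<^sub>F n in sequentially. - (\<delta> / 2) < (\<integral>t. min 0 (real n + \<phi> t) \<partial>unit_lborel)"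
    using \<delta> by (intro order_tendstoD(1)[OF integral_min_0_of_nat_add_tendsto_0[OF int]]) simp
  from eventually_happens'[OF _ eventually_conj[OF eventually_gt_at_top[of 0] this]]
  obtain n where n: "0 < n" "- (\<delta> / 2) < (\<integral>t. min 0 (real n + \<phi> t) \<partial>unit_lborel)" by auto
  define \<psi> where "\<psi> t = max (\<phi> t) (- real n)" for t
  have i\<psi> [measurable]: "integrable unit_lborel \<psi>"
    unfolding \<psi>_def using int by simp
  have truncation: "min 0 (real n + \<phi> t) = \<phi> t - \<psi> t" for t
    by (simp add: \<psi>_def)
  have bounds: "AE t in unit_lborel. - real n \<le> \<psi> t \<and> \<psi> t \<le> 0"
    using neg by (simp add: \<psi>_def)
  have "- real n < 0" "0 < \<delta> / 2"
    using n \<delta> by simp_all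
  then obtain Q where Q: "\<And>z. cmod z = 1 \<Longrightarrow> Re (poly Q z) \<le> 0"
    and Q_close: "(\<integral>t. \<bar>\<psi> t - Re (poly Q (circ t))\<bar> \<partial>unit_lborel) \<le> \<delta> / 2"
    using Re_poly_L1_approx[OF borel_measurable_integrable[OF i\<psi>] bounds] by blast
  have "(\<integral>t. \<bar>\<phi> t - Re (poly Q (circ t))\<bar> \<partial>unit_lborel)
      \<le> (\<integral>t. \<bar>\<psi> t - Re (poly Q (circ t))\<bar> - (\<phi> t - \<psi> t) \<partial>unit_lborel)"
    using int i\<psi> integrable_Re_poly_circ[of Q] by (intro integral_mono) (auto simp: \<psi>_def)
  also have "\<dots> = (\<integral>t. \<bar>\<psi> t - Re (poly Q (circ t))\<bar> \<partial>unit_lborel)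
      - (\<integral>t. \<phi> t - \<psi> t \<partial>unit_lborel)"
    using int i\<psi> integrable_Re_poly_circ[of Q] by (intro Bochner_Integration.integral_diff) auto
  also have "\<dots> \<le> \<delta>"
    using Q_close n(2) unfolding truncation by linarith
  finally show ?thesis
    using Q by (intro that[of "Q - [:\<i> * of_real (Im (poly Q 0)):]"]) auto
qed

lemma integral_le_Re_poly_0:
  fixes \<phi> :: "real \<Rightarrow> real"
  assumes int: "integrable unit_lborel \<phi>"
    and P_close: "(\<integral>t. \<bar>\<phi> t - Re (poly P (circ t))\<bar> \<partial>unit_lborel) \<le> \<delta>"
  shows "(\<integral>t. \<phi> t \<partial>unit_lborel) - \<delta> \<le> Re (poly P 0)"
proof -
  have "(\<integral>t. \<phi> t \<partial>unit_lborel) - Re (poly P 0) = (\<integral>t. \<phi> t - Re (poly P (circ t)) \<partial>unit_lborel)"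
    using int integrable_Re_poly_circ[of P] by (simp add: integral_Re_poly_circ)
  also have "\<dots> \<le> (\<integral>t. \<bar>\<phi> t - Re (poly P (circ t))\<bar> \<partial>unit_lborel)"
    using int integrable_Re_poly_circ[of P] by (intro integral_mono) auto
  finally show ?thesis using P_close by linarith
qed

lemma l2_norm_exp_poly_minus_1_le:
  assumes P: "\<And>z. cmod z = 1 \<Longrightarrow> Re (poly P z) \<le> 0" and P0: "Im (poly P 0) = 0"
  shows "(l2_norm unit_lborel (\<lambda>t. exp (poly P (circ t)) - 1))\<^sup>2 \<le> - 2 * Re (poly P 0)"
proof -
  have int: "integrable unit_lborel (\<lambda>t. exp (poly P (circ t)))"
    by (rule integrable_circ) (intro continuous_intros)
  have sq: "square_integrable unit_lborel (\<lambda>t. exp (poly P (circ t)) - 1)"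
    by (rule square_integrable_circ) (intro continuous_intros)
  have "(cmod (w - 1))\<^sup>2 \<le> 2 - 2 * Re w" if "cmod w \<le> 1" for w
    using that power_mono[of "cmod w" 1 2] by (simp add: cmod_power2 power2_diff)
  then have "(l2_norm unit_lborel (\<lambda>t. exp (poly P (circ t)) - 1))\<^sup>2
      \<le> (\<integral>t. 2 - 2 * Re (exp (poly P (circ t))) \<partial>unit_lborel)"
    unfolding l2_norm_power2 using sq int P
    by (intro integral_mono square_integrable_integrable_norm_power2 Bochner_Integration.integrable_diff
        integrable_mult_right integrable_Re) auto
  also have "\<dots> = 2 - 2 * Re (\<integral>t. exp (poly P (circ t)) \<partial>unit_lborel)"
    using integrable_Re[OF int] integral_Re[OF int] unit_lborel.prob_space
    by (subst Bochner_Integration.integral_diff) (auto simp del: Re_exp)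
  also have "(\<integral>t. exp (poly P (circ t)) \<partial>unit_lborel) = exp (poly P 0)"
    by (rule integral_circ_mean_value) (intro continuous_intros holomorphic_intros)+
  also have "Re (exp (poly P 0)) = exp (Re (poly P 0))"
    using P0 by (simp add: Re_exp)
  also have "2 - 2 * exp (Re (poly P 0)) \<le> - 2 * Re (poly P 0)"
    using exp_ge_add_one_self[of "Re (poly P 0)"] by linarith
  finally show ?thesis .
qed

lemma power_mult_one_minus_power_le:
  fixes y :: real
  assumes y: "0 \<le> y" "y \<le> 1" and n: "0 < n" and m: "0 < m"
  shows "(1 - y) ^ n * y ^ m \<le> (real m / real n) ^ m"
proof -
  have "(1 - y) ^ n \<le> exp (- y) ^ n"
    using y exp_ge_add_one_self[of "- y"] by (intro power_mono) auto
  also have "\<dots> = exp (- (real n * y))"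
    by (simp add: exp_of_nat_mult[symmetric])
  finally have le_exp: "(1 - y) ^ n \<le> exp (- (real n * y))" .
  have "real n * y / real m \<le> exp (real n * y / real m)"
    using exp_ge_add_one_self[of "real n * y / real m"] by linarith
  then have "(real n * y / real m) ^ m \<le> exp (real n * y / real m) ^ m"
    using y by (intro power_mono) auto
  also have "\<dots> = exp (real n * y)"
    using m by (simp add: exp_of_nat_mult[symmetric])
  finally have power_le_exp: "(real n * y / real m) ^ m \<le> exp (real n * y)" .
  have "y ^ m = (real n * y / real m) ^ m * (real m / real n) ^ m"
    using n m by (simp flip: power_mult_distrib)
  then have "(1 - y) ^ n * y ^ m = ((1 - y) ^ n * (real n * y / real m) ^ m) * (real m / real n) ^ m"
    by simp
  also have "\<dots> \<le> (exp (- (real n * y)) * exp (real n * y)) * (real m / real n) ^ m"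
    using le_exp power_le_exp y by (intro mult_right_mono mult_mono) auto
  finally show ?thesis by (simp flip: exp_add)
qed

lemma inverse_power_mult_exp_min_le:
  fixes x :: real
  assumes x: "1 < x" and n: "0 < n" and m: "0 < m"
  shows "inverse x ^ n * exp (min 0 (L + real m * ln (1 - 1 / x))) \<le> exp L * (real m / real n) ^ m"
proof -
  define y where "y = 1 - 1 / x"
  have y: "0 < y" "y \<le> 1" and inverse_x: "inverse x = 1 - y"
    using x by (auto simp: y_def field_simps)
  have "exp (min 0 (L + real m * ln y)) \<le> exp (L + real m * ln y)"
    by simp
  also have "\<dots> = exp L * y ^ m"
    using y by (simp add: exp_add exp_of_nat_mult)
  finally have "(1 - y) ^ n * exp (min 0 (L + real m * ln y)) \<le> (1 - y) ^ n * (exp L * y ^ m)"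
    using y by (intro mult_left_mono) auto
  also have "\<dots> = exp L * ((1 - y) ^ n * y ^ m)" by simp
  also have "\<dots> \<le> exp L * (real m / real n) ^ m"
    using y n m by (intro mult_left_mono power_mult_one_minus_power_le) auto
  finally show ?thesis
    by (simp add: inverse_x flip: y_def)
qed

lemma abs_exp_diff_le:
  fixes a b :: real
  assumes "a \<le> 0" "b \<le> 0"
  shows "\<bar>exp a - exp b\<bar> \<le> \<bar>a - b\<bar>"
proof -
  have exp_diff_le: "exp x - exp y \<le> x - y" if "y \<le> x" "x \<le> 0" for x y :: real
  proof -
    have "exp x - exp y = exp x * (1 - exp (y - x))"
      by (simp add: right_diff_distrib flip: exp_add)
    also have "1 - exp (y - x) \<le> x - y"
      using exp_ge_add_one_self[of "y - x"] by linarith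
    then have "exp x * (1 - exp (y - x)) \<le> 1 * (x - y)"
      using that by (intro mult_mono) auto
    finally show ?thesis by simp
  qed
  show ?thesis
    using exp_diff_le[of a b] exp_diff_le[of b a] assms by (cases "a \<le> b") auto
qed

lemma mult_exp_power2_le:
  fixes x a p E :: real
  assumes x: "0 \<le> x" "x \<le> 1" and a: "a \<le> 0" "x * exp a \<le> E" and p: "p \<le> 0"
  shows "(x * exp p)\<^sup>2 \<le> E\<^sup>2 + 2 * \<bar>a - p\<bar>"
proof -
  have "x\<^sup>2 * (exp (2 * p) - exp (2 * a)) \<le> x\<^sup>2 * \<bar>exp (2 * p) - exp (2 * a)\<bar>"
    by (intro mult_left_mono) auto
  also have "\<dots> \<le> 1 * \<bar>2 * p - 2 * a\<bar>"
    using x a p by (intro mult_mono abs_exp_diff_le) (auto simp: power_le_one)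
  also have "\<dots> = 2 * \<bar>a - p\<bar>"
    by (simp add: abs_if)
  finally have "x\<^sup>2 * (exp (2 * p) - exp (2 * a)) \<le> 2 * \<bar>a - p\<bar>" .
  moreover have "(x * exp a)\<^sup>2 \<le> E\<^sup>2"
    using x a by (intro power_mono) auto
  moreover have "(x * exp p)\<^sup>2 = (x * exp a)\<^sup>2 + x\<^sup>2 * (exp (2 * p) - exp (2 * a))"
    by (simp add: power_mult_distrib exp_double right_diff_distrib)
  ultimately show ?thesis by linarith
qed

lemma (in prob_space) l2_norm_mult_exp_le:
  fixes u p :: "'a \<Rightarrow> complex" and \<phi> :: "'a \<Rightarrow> real"
  assumes u: "AE x in M. cmod (u x) \<le> 1 \<and> cmod (u x) * exp (\<phi> x) \<le> E"
    and \<phi>: "\<And>x. \<phi> x \<le> 0" and p: "\<And>x. Re (p x) \<le> 0"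
    and int: "integrable M (\<lambda>x. \<phi> x - Re (p x))"
  shows "(l2_norm M (\<lambda>x. u x * exp (p x)))\<^sup>2 \<le> E\<^sup>2 + 2 * (\<integral>x. \<bar>\<phi> x - Re (p x)\<bar> \<partial>M)"
proof -
  have "(l2_norm M (\<lambda>x. u x * exp (p x)))\<^sup>2 \<le> (\<integral>x. E\<^sup>2 + 2 * \<bar>\<phi> x - Re (p x)\<bar> \<partial>M)"
    unfolding l2_norm_power2
  proof (rule integral_mono_AE')
    show "AE x in M. (cmod (u x * exp (p x)))\<^sup>2 \<le> E\<^sup>2 + 2 * \<bar>\<phi> x - Re (p x)\<bar>"
      using u
    proof eventually_elim
      case (elim x)
      then show ?case
        using mult_exp_power2_le[of "cmod (u x)" "\<phi> x" E "Re (p x)"] \<phi> p by (simp add: norm_mult)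
    qed
  qed (use int in auto)
  also have "\<dots> = E\<^sup>2 + 2 * (\<integral>x. \<bar>\<phi> x - Re (p x)\<bar> \<partial>M)"
    using int prob_space by simp
  finally show ?thesis .
qed

lemma l2_norm_power_mult_exp_poly_diff_le:
  assumes P: "\<And>z. cmod z = 1 \<Longrightarrow> Re (poly P z) \<le> 0" "Im (poly P 0) = 0"
    and P0: "- (\<epsilon>\<^sup>2 / 2) \<le> Re (poly P 0)" and \<epsilon>: "0 \<le> \<epsilon>"
  shows "l2_norm unit_lborel (\<lambda>t. circ t ^ j * exp (poly P (circ t)) - circ t ^ j) \<le> \<epsilon>"
proof (rule power2_le_imp_le[OF _ \<epsilon>])
  have "cmod (circ t ^ j * exp (poly P (circ t)) - circ t ^ j) = cmod (exp (poly P (circ t)) - 1)" for t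
    using norm_mult[of "circ t ^ j" "exp (poly P (circ t)) - 1"]
    by (simp add: right_diff_distrib norm_power)
  then have "(l2_norm unit_lborel (\<lambda>t. circ t ^ j * exp (poly P (circ t)) - circ t ^ j))\<^sup>2
      = (l2_norm unit_lborel (\<lambda>t. exp (poly P (circ t)) - 1))\<^sup>2"
    by (simp add: l2_norm_def)
  also have "\<dots> \<le> - 2 * Re (poly P 0)"
    by (rule l2_norm_exp_poly_minus_1_le[OF P])
  finally show "(l2_norm unit_lborel (\<lambda>t. circ t ^ j * exp (poly P (circ t)) - circ t ^ j))\<^sup>2 \<le> \<epsilon>\<^sup>2"
    using P0 by linarith
qed

lemma l2_norm_inverse_power_mult_exp_poly_le:
  fixes b :: "real \<Rightarrow> complex" and L :: real and m :: nat
  defines "\<phi> \<equiv> \<lambda>t. min 0 (L + real m * ln (1 - 1 / cmod (b t)))"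
  assumes b: "AE t in unit_lborel. 1 < cmod (b t)" and int: "integrable unit_lborel \<phi>"
    and P: "\<And>z. cmod z = 1 \<Longrightarrow> Re (poly P z) \<le> 0"
    and P_close: "(\<integral>t. \<bar>\<phi> t - Re (poly P (circ t))\<bar> \<partial>unit_lborel) \<le> (exp L * (real m / real n) ^ m)\<^sup>2"
    and n: "0 < n" and m: "0 < m"
  shows "l2_norm unit_lborel (\<lambda>t. inverse (b t) ^ n * (circ t ^ j * exp (poly P (circ t))))
    \<le> 2 * (exp L * (real m / real n) ^ m)"
proof (rule power2_le_imp_le)
  define E where "E = exp L * (real m / real n) ^ m"
  have "AE t in unit_lborel. cmod (inverse (b t) ^ n * circ t ^ j) \<le> 1
      \<and> cmod (inverse (b t) ^ n * circ t ^ j) * exp (\<phi> t) \<le> E"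
    using b
  proof eventually_elim
    case (elim t)
    then show ?case
      using inverse_power_mult_exp_min_le[OF elim n m, of L] norm_inverse_power_le_1[of "b t" n]
      by (simp add: \<phi>_def E_def norm_mult norm_power norm_inverse)
  qed
  then have "(l2_norm unit_lborel (\<lambda>t. inverse (b t) ^ n * circ t ^ j * exp (poly P (circ t))))\<^sup>2
      \<le> E\<^sup>2 + 2 * (\<integral>t. \<bar>\<phi> t - Re (poly P (circ t))\<bar> \<partial>unit_lborel)"
    using P int integrable_Re_poly_circ[of P]
    by (intro unit_lborel.l2_norm_mult_exp_le) (auto simp: \<phi>_def)
  also have "\<dots> \<le> E\<^sup>2 + 3 * E\<^sup>2"
    using P_close zero_le_power2[of E] unfolding E_def by linarith
  also have "\<dots> = (2 * E)\<^sup>2"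
    by (simp add: power_mult_distrib)
  finally show "(l2_norm unit_lborel (\<lambda>t. inverse (b t) ^ n * (circ t ^ j * exp (poly P (circ t)))))\<^sup>2
      \<le> (2 * (exp L * (real m / real n) ^ m))\<^sup>2"
    by (simp add: E_def mult.assoc)
qed simp

lemma exists_test_functions:
  assumes b: "AE t in unit_lborel. 1 < cmod (b t)"
    and int: "integrable unit_lborel (\<lambda>t. ln (1 - 1 / cmod (b t)))" and m: "0 < m" and \<epsilon>: "0 < \<epsilon>"
  obtains A where "0 < A" "\<And>n. 0 < n \<Longrightarrow> \<exists>F. F holomorphic_on UNIV
    \<and> l2_norm unit_lborel (\<lambda>t. F (circ t) - circ t ^ j) \<le> \<epsilon>
    \<and> l2_norm unit_lborel (\<lambda>t. inverse (b t) ^ n * F (circ t)) \<le> A / real n ^ m"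
proof -
  have int_m: "integrable unit_lborel (\<lambda>t. real m * ln (1 - 1 / cmod (b t)))"
    using int by simp
  have "\<forall>\<^sub>F N in sequentially.
      - (\<epsilon>\<^sup>2 / 4) < (\<integral>t. min 0 (real N + real m * ln (1 - 1 / cmod (b t))) \<partial>unit_lborel)"
    using \<epsilon> by (intro order_tendstoD(1)[OF integral_min_0_of_nat_add_tendsto_0[OF int_m]]) simp
  then obtain N where
    N: "- (\<epsilon>\<^sup>2 / 4) < (\<integral>t. min 0 (real N + real m * ln (1 - 1 / cmod (b t))) \<partial>unit_lborel)"
    by (auto simp: eventually_sequentially)
  define \<phi> where "\<phi> t = min 0 (real N + real m * ln (1 - 1 / cmod (b t)))" for t
  have i\<phi>: "integrable unit_lborel \<phi>" and \<phi>: "\<And>t. \<phi> t \<le> 0"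
    using int_m by (simp_all add: \<phi>_def[abs_def])
  have "\<exists>F. F holomorphic_on UNIV \<and> l2_norm unit_lborel (\<lambda>t. F (circ t) - circ t ^ j) \<le> \<epsilon>
      \<and> l2_norm unit_lborel (\<lambda>t. inverse (b t) ^ n * F (circ t)) \<le> 2 * exp N * real m ^ m / real n ^ m"
    if n: "0 < n" for n
  proof -
    define \<delta> where "\<delta> = min (\<epsilon>\<^sup>2 / 4) ((exp N * (real m / real n) ^ m)\<^sup>2)"
    have \<delta>: "0 < \<delta>" "\<delta> \<le> \<epsilon>\<^sup>2 / 4" "\<delta> \<le> (exp N * (real m / real n) ^ m)\<^sup>2"
      using \<epsilon> n m by (auto simp: \<delta>_def)
    obtain P where P: "\<And>z. cmod z = 1 \<Longrightarrow> Re (poly P z) \<le> 0" "Im (poly P 0) = 0"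
      and P_close: "(\<integral>t. \<bar>\<phi> t - Re (poly P (circ t))\<bar> \<partial>unit_lborel) \<le> \<delta>"
      using nonpos_Re_poly_L1_approx[OF i\<phi> \<phi> \<delta>(1)] by blast
    have "- (\<epsilon>\<^sup>2 / 2) \<le> Re (poly P 0)"
      using integral_le_Re_poly_0[OF i\<phi> P_close] N \<delta>(2) by (simp add: \<phi>_def)
    then have "l2_norm unit_lborel (\<lambda>t. circ t ^ j * exp (poly P (circ t)) - circ t ^ j) \<le> \<epsilon>"
      using P \<epsilon> by (intro l2_norm_power_mult_exp_poly_diff_le) auto
    moreover have "l2_norm unit_lborel (\<lambda>t. inverse (b t) ^ n * (circ t ^ j * exp (poly P (circ t))))
        \<le> 2 * (exp N * (real m / real n) ^ m)"
      using i\<phi> P_close \<delta>(3) unfolding \<phi>_def[abs_def]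
      by (intro l2_norm_inverse_power_mult_exp_poly_le b P(1) n m) linarith+
    moreover have "(\<lambda>z. z ^ j * exp (poly P z)) holomorphic_on UNIV"
      by (intro holomorphic_intros)
    ultimately show ?thesis
      by (intro exI[of _ "\<lambda>z. z ^ j * exp (poly P z)"]) (simp add: power_divide)
  qed
  then show ?thesis
    using m by (intro that[of "2 * exp N * real m ^ m"]) auto
qed

lemma (in finite_measure) integrable_ln_one_minus_inverse:
  fixes x :: "'a \<Rightarrow> real"
  assumes [measurable]: "x \<in> borel_measurable M"
    and x: "AE t in M. 1 < x t" "AE t in M. x t \<le> C"
    and int: "integrable M (\<lambda>t. ln (x t - 1))"
  shows "integrable M (\<lambda>t. ln (1 - 1 / x t))"
proof -
  have "integrable M (\<lambda>t. ln (x t))"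
  proof (rule integrable_const_bound)
    show "AE t in M. norm (ln (x t)) \<le> ln C"
      using x
    proof eventually_elim
      case (elim t)
      then show ?case by (simp add: ln_mono)
    qed
  qed measurable
  then have "integrable M (\<lambda>t. ln (x t - 1) - ln (x t))"
    using int by simp
  moreover have "AE t in M. ln (x t - 1) - ln (x t) = ln (1 - 1 / x t)"
    using x(1)
  proof eventually_elim
    case (elim t)
    then have "1 - 1 / x t = (x t - 1) / x t"
      by (simp add: diff_divide_distrib)
    then show ?case
      using elim by (simp add: ln_div)
  qed
  ultimately show ?thesis
    by (subst (asm) integrable_cong_AE) auto
qed

section \<open>Iterates of the adjoint Toeplitz operator\<close>

lemma Hinf_poly_limit: "Hinf g \<Longrightarrow> poly_limit (\<lambda>t. g (circ t))"
  by (simp add: Hinf_def H2_iff_poly_limit)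

lemma Hinf_bounded:
  assumes "Hinf g"
  obtains C where "AE t in unit_lborel. cmod (g (circ t)) \<le> C"
  using assms unfolding Hinf_def AE_unit_lborel by blast

lemma L2T_cnj_mult:
  assumes g: "Hinf g" and f: "L2T f"
  shows "L2T (\<lambda>z. cnj (g z) * f z)"
proof -
  obtain C where C: "AE t in unit_lborel. cmod (g (circ t)) \<le> C"
    using Hinf_bounded[OF g] .
  have [measurable]: "(\<lambda>t. g (circ t)) \<in> borel_measurable lborel" "(\<lambda>t. f (circ t)) \<in> borel_measurable lborel"
    and sg: "square_integrable unit_lborel (\<lambda>t. g (circ t))"
    and sf: "square_integrable unit_lborel (\<lambda>t. f (circ t))"
    using g f by (auto simp: Hinf_def H2_def L2T_iff)
  have "square_integrable unit_lborel (\<lambda>t. cnj (g (circ t)) * f (circ t))"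
    by (rule square_integrable_bounded_mult[OF sf, where C=C])
       (use sg C in \<open>auto intro: square_integrable_measurable square_integrable_cnj\<close>)
  then show ?thesis
    by (simp add: L2T_iff)
qed

lemma H2_Toeplitz_adj: "Hinf g \<Longrightarrow> H2 f \<Longrightarrow> H2 (Toeplitz_adj g f)"
  unfolding Toeplitz_adj_def by (intro H2_Proj L2T_cnj_mult) (auto simp: H2_def)

lemma H2_Toeplitz_adj_pow: "Hinf g \<Longrightarrow> H2 f \<Longrightarrow> H2 ((Toeplitz_adj g ^^ n) f)"
  by (induction n) (auto intro: H2_Toeplitz_adj)

lemma l2_inner_Toeplitz_adj:
  assumes g: "Hinf g" and f: "H2 f" and b: "poly_limit b"
  shows "l2_inner unit_lborel (\<lambda>t. Toeplitz_adj g f (circ t)) b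
    = l2_inner unit_lborel (\<lambda>t. f (circ t)) (\<lambda>t. g (circ t) * b t)"
proof -
  have "L2T (\<lambda>z. cnj (g z) * f z)"
    using f by (intro L2T_cnj_mult[OF g]) (simp add: H2_def)
  then show ?thesis
    unfolding Toeplitz_adj_def by (subst l2_inner_Proj[OF _ b]) (simp_all add: l2_inner_def mult_ac)
qed


lemma poly_limit_Hinf_inverse_power_mult:
  assumes "Hinf g" "AE t in unit_lborel. 1 \<le> cmod (g (circ t))"
    and "\<And>z. cmod z < 1 \<Longrightarrow> 1 \<le> cmod (disc_ext g z)" and "F holomorphic_on UNIV"
  shows "poly_limit (\<lambda>t. inverse (g (circ t)) ^ k * F (circ t))"
  by (rule poly_limit_inverse_power_mult)
     (use assms in \<open>auto simp: disc_ext_eq_disc_series Hinf_poly_limit\<close>)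

lemma l2_inner_Toeplitz_adj_pow:
  assumes g: "Hinf g" and ext_ge: "\<And>z. cmod z < 1 \<Longrightarrow> 1 \<le> cmod (disc_ext g z)"
    and g_ge: "AE t in unit_lborel. 1 \<le> cmod (g (circ t))"
    and f: "H2 f" and F: "F holomorphic_on UNIV"
  shows "l2_inner unit_lborel (\<lambda>t. (Toeplitz_adj g ^^ n) f (circ t)) (\<lambda>t. inverse (g (circ t)) ^ n * F (circ t))
    = l2_inner unit_lborel (\<lambda>t. f (circ t)) (\<lambda>t. F (circ t))"
proof (induction n)
  case (Suc n)
  define u where "u k = (\<lambda>t. inverse (g (circ t)) ^ k * F (circ t))" for k
  have u: "poly_limit (u k)" for k
    unfolding u_def by (rule poly_limit_Hinf_inverse_power_mult[OF g g_ge ext_ge F])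
  let ?f\<^sub>n = "(Toeplitz_adj g ^^ n) f"
  have fn: "H2 ?f\<^sub>n"
    by (rule H2_Toeplitz_adj_pow[OF g f])
  have "l2_inner unit_lborel (\<lambda>t. (Toeplitz_adj g ^^ Suc n) f (circ t)) (u (Suc n))
      = l2_inner unit_lborel (\<lambda>t. ?f\<^sub>n (circ t)) (\<lambda>t. g (circ t) * u (Suc n) t)"
    using l2_inner_Toeplitz_adj[OF g fn u] by simp
  also have "\<dots> = l2_inner unit_lborel (\<lambda>t. ?f\<^sub>n (circ t)) (u n)"
  proof (rule l2_inner_cong_AE)
    note [measurable] = H2_square_integrable[OF fn] poly_limit_square_integrable[OF u]
      poly_limit_square_integrable[OF Hinf_poly_limit[OF g]]
    show "(\<lambda>t. ?f\<^sub>n (circ t)) \<in> borel_measurable unit_lborel"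
      and "(\<lambda>t. g (circ t) * u (Suc n) t) \<in> borel_measurable unit_lborel"
      and "u n \<in> borel_measurable unit_lborel"
      by measurable
    show "AE t in unit_lborel. g (circ t) * u (Suc n) t = u n t"
      using g_ge
    proof eventually_elim
      case (elim t)
      then have "g (circ t) \<noteq> 0" by auto
      then show ?case by (simp add: u_def)
    qed
  qed
  also have "\<dots> = l2_inner unit_lborel (\<lambda>t. f (circ t)) (\<lambda>t. F (circ t))"
    unfolding u_def by (rule Suc.IH)
  finally show ?case
    unfolding u_def .
qed simp

lemma Hinf_integrable_ln_one_minus_inverse:
  assumes g: "Hinf g" and g_gr: "AE t in unit_lborel. 1 < cmod (g (circ t))"
    and ln_g: "integrable unit_lborel (\<lambda>t. ln (cmod (g (circ t)) - 1))"
  shows "integrable unit_lborel (\<lambda>t. ln (1 - 1 / cmod (g (circ t))))"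
proof -
  have [measurable]: "square_integrable unit_lborel (\<lambda>t. g (circ t))"
    by (rule poly_limit_square_integrable[OF Hinf_poly_limit[OF g]])
  obtain C where "AE t in unit_lborel. cmod (g (circ t)) \<le> C"
    using Hinf_bounded[OF g] .
  then show ?thesis
    by (intro unit_lborel.integrable_ln_one_minus_inverse[OF _ g_gr _ ln_g]) measurable
qed

lemma H2_nonzero_fourier_coeff:
  assumes f: "H2 f" and nz: "\<not> (AE t in unit_lborel. f (circ t) = 0)"
  obtains j where "fourier_coeff (\<lambda>t. f (circ t)) j \<noteq> 0"
proof (rule ccontr)
  assume "\<not> thesis"
  then have analytic: "fourier_coeff (\<lambda>t. f (circ t)) n = 0" for n
    using that by blast
  have "neg_fourier_coeff (\<lambda>t. f (circ t)) n = 0" for n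
  proof (cases n)
    case 0
    then show ?thesis using analytic[of 0] by simp
  next
    case (Suc k)
    then show ?thesis using f by (simp add: H2_iff del: power_Suc)
  qed
  then have "AE t in unit_lborel. f (circ t) = 0"
    by (rule fourier_uniqueness[OF H2_square_integrable[OF f] analytic])
  with nz show False ..
qed

lemma norm_l2_inner_le_L2norm_Toeplitz_adj_pow:
  assumes g: "Hinf g" and ext_ge: "\<And>z. cmod z < 1 \<Longrightarrow> 1 \<le> cmod (disc_ext g z)"
    and g_ge: "AE t in unit_lborel. 1 \<le> cmod (g (circ t))"
    and f: "H2 f" and F: "F holomorphic_on UNIV"
  shows "cmod (l2_inner unit_lborel (\<lambda>t. f (circ t)) (\<lambda>t. F (circ t)))
    \<le> L2norm ((Toeplitz_adj g ^^ n) f) * l2_norm unit_lborel (\<lambda>t. inverse (g (circ t)) ^ n * F (circ t))"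
proof -
  have "cmod (l2_inner unit_lborel (\<lambda>t. (Toeplitz_adj g ^^ n) f (circ t))
        (\<lambda>t. inverse (g (circ t)) ^ n * F (circ t)))
      \<le> L2norm ((Toeplitz_adj g ^^ n) f) * l2_norm unit_lborel (\<lambda>t. inverse (g (circ t)) ^ n * F (circ t))"
    unfolding L2norm_eq_l2_norm
    by (intro norm_l2_inner_le H2_square_integrable H2_Toeplitz_adj_pow g f
        poly_limit_square_integrable[OF poly_limit_Hinf_inverse_power_mult[OF g g_ge ext_ge F]])
  then show ?thesis
    by (subst (asm) l2_inner_Toeplitz_adj_pow[OF g ext_ge g_ge f F])
qed

lemma L2norm_Toeplitz_adj_pow_ge:
  assumes g: "Hinf g" and ext_ge: "\<And>z. cmod z < 1 \<Longrightarrow> 1 \<le> cmod (disc_ext g z)"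
    and g_gr: "AE t in unit_lborel. 1 < cmod (g (circ t))"
    and ln_g: "integrable unit_lborel (\<lambda>t. ln (cmod (g (circ t)) - 1))"
    and f: "H2 f" and nz: "\<not> (AE t in unit_lborel. f (circ t) = 0)" and m: "0 < m"
  obtains c where "0 < c" "\<And>n. 0 < n \<Longrightarrow> c * real n ^ m \<le> L2norm ((Toeplitz_adj g ^^ n) f)"
proof -
  obtain j where "fourier_coeff (\<lambda>t. f (circ t)) j \<noteq> 0"
    using H2_nonzero_fourier_coeff[OF f nz] .
  moreover define a where "a = cmod (fourier_coeff (\<lambda>t. f (circ t)) j)"
  moreover define \<epsilon> where "\<epsilon> = a / (2 * (l2_norm unit_lborel (\<lambda>t. f (circ t)) + 1))"
  ultimately have a: "0 < a" and \<epsilon>: "0 < \<epsilon>"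
    by (simp_all add: add_nonneg_pos)
  obtain A where A: "0 < A" and test: "\<And>n. 0 < n \<Longrightarrow> \<exists>F. F holomorphic_on UNIV
    \<and> l2_norm unit_lborel (\<lambda>t. F (circ t) - circ t ^ j) \<le> \<epsilon>
    \<and> l2_norm unit_lborel (\<lambda>t. inverse (g (circ t)) ^ n * F (circ t)) \<le> A / real n ^ m"
    using exists_test_functions[OF g_gr Hinf_integrable_ln_one_minus_inverse[OF g g_gr ln_g] m \<epsilon>] by blast
  have g_ge: "AE t in unit_lborel. 1 \<le> cmod (g (circ t))"
    using g_gr by eventually_elim simp
  have "a / (2 * A) * real n ^ m \<le> L2norm ((Toeplitz_adj g ^^ n) f)" if n: "0 < n" for n
  proof -
    obtain F where F: "F holomorphic_on UNIV"
      and F_close: "l2_norm unit_lborel (\<lambda>t. F (circ t) - circ t ^ j) \<le> \<epsilon>"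
      and F_small: "l2_norm unit_lborel (\<lambda>t. inverse (g (circ t)) ^ n * F (circ t)) \<le> A / real n ^ m"
      using test[OF n] by blast
    have "square_integrable unit_lborel (\<lambda>t. F (circ t))"
      by (rule square_integrable_circ[OF holomorphic_on_imp_continuous_on[OF holomorphic_on_subset[OF F]]]) simp
    from norm_l2_inner_ge_half[OF H2_square_integrable[OF f] square_integrable_circ_power this] F_close
    have "a / 2 \<le> cmod (l2_inner unit_lborel (\<lambda>t. f (circ t)) (\<lambda>t. F (circ t)))"
      by (simp add: a_def \<epsilon>_def)
    also have "\<dots> \<le> L2norm ((Toeplitz_adj g ^^ n) f)
        * l2_norm unit_lborel (\<lambda>t. inverse (g (circ t)) ^ n * F (circ t))"
      by (rule norm_l2_inner_le_L2norm_Toeplitz_adj_pow[OF g ext_ge g_ge f F])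
    also have "\<dots> \<le> L2norm ((Toeplitz_adj g ^^ n) f) * (A / real n ^ m)"
      using F_small by (intro mult_left_mono) (simp_all add: L2norm_eq_l2_norm)
    finally show ?thesis
      using A n by (simp add: field_simps)
  qed
  then show ?thesis
    using a A by (intro that[of "a / (2 * A)"]) auto
qed

lemma filterlim_powr_minus_mult_at_top:
  fixes a :: "nat \<Rightarrow> real"
  assumes c: "0 < c" and a: "\<And>n. 0 < n \<Longrightarrow> c * real n ^ m \<le> a n" and k: "k < real m"
  shows "filterlim (\<lambda>n. real n powr (- k) * a n) at_top sequentially"
proof (rule filterlim_at_top_mono)
  show "filterlim (\<lambda>n. c * real n powr (real m - k)) at_top sequentially"
    using c k by real_asymp
  show "\<forall>\<^sub>F n in sequentially. c * real n powr (real m - k) \<le> real n powr (- k) * a n"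
    using eventually_gt_at_top[of 0]
  proof eventually_elim
    case (elim n)
    have "c * real n powr (real m - k) = real n powr (- k) * (c * real n ^ m)"
      using elim by (simp add: powr_diff powr_minus powr_realpow field_simps)
    also have "\<dots> \<le> real n powr (- k) * a n"
      using a[OF elim] by (intro mult_left_mono) auto
    finally show ?case .
  qed
qed

theorem theorem6p2:
  fixes g f :: "complex \<Rightarrow> complex" and k :: real
  assumes "Hinf g"
    and "\<forall>z. cmod z < 1 \<longrightarrow> cmod (disc_ext g z) \<ge> 1"
    and "AE t in lborel. t \<in> {0..1} \<longrightarrow> cmod (g (circ t)) > 1"
    and "set_integrable lborel {0..1} (\<lambda>t. ln (cmod (g (circ t)) - 1))"
    and "k > 0"
    and "H2 f"
    and "\<not> (AE t in lborel. t \<in> {0..1} \<longrightarrow> f (circ t) = 0)"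
  shows "filterlim (\<lambda>n. real n powr (- k) * L2norm ((Toeplitz_adj g ^^ n) f)) at_top sequentially"
proof -
  obtain m where m: "k < real m"
    using reals_Archimedean2 by blast
  then have "0 < m"
    using \<open>k > 0\<close> by (cases m) auto
  then obtain c where "0 < c" "\<And>n. 0 < n \<Longrightarrow> c * real n ^ m \<le> L2norm ((Toeplitz_adj g ^^ n) f)"
    using L2norm_Toeplitz_adj_pow_ge[of g f m] assms
    unfolding AE_unit_lborel[symmetric] set_integrable_unit_lborel by blast
  then show ?thesis
    using m by (rule filterlim_powr_minus_mult_at_top)
qed

end
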